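(* Consider the following online problem (online matching with reusable resources, OMR). There is a finite set $I$ of resources, each with a single unit of inventory and a reward $r_i\ge 0$, and a known usage duration $d>0$. Arrivals $t\in T$ come one at a time in an order chosen by an adversary, at nondecreasing times $a(t)$. When arrival $t$ occurs, the set of edges $(i,t)\in E$ incident to $t$ is revealed, and the algorithm must immediately and irrevocably either match $t$ to a neighbouring resource $i$ that is currently available, collecting reward $r_i$, or leave $t$ unmatched. A resource matched to $t$ is unavailable during the time interval $(a(t),a(t)+d]$ and is available again afterwards. The offline optimum $\mathrm{Offline}(G)$ of an instance $G=(I,T,E,(a(t))_{t\in T},(r_i)_{i\in I},d)$ is the maximum total reward of a feasible matching chosen with full knowledge of the instance. Consider the Periodic Reranking algorithm with parameter $\beta=0.89$, defined as follows. Let $g(x)=e^{\beta(x-1)}$. Time is partitioned into consecutive periods of length $d$. At the start of every period, the algorithm draws fresh seeds $y_i\sim U[0,1]$ for all $i\in I$, independently of each other and of all previous draws. Each arrival $t$ is matched to an available resource $i$ with $(i,t)\in E$ that maximizes $r_i(1-g(y_i))$, where $y_i$ is the current seed of $i$; if no neighbour of $t$ is available, $t$ is left unmatched. Then this algorithm is $0.589$-competitive: for every instance $G$, its expected total reward is at least $0.589\cdot \mathrm{Offline}(G)$. *)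

theory Defs
  imports "HOL-Probability.Probability"
begin

text \<open>Arrivals are indexed by \<open>0, \<dots>, num_arrivals - 1\<close> in the order in which they come.\<close>

record 'i omr =
  resources :: "'i set"
  num_arrivals :: nat
  edges :: "('i \<times> nat) set"
  arr_time :: "nat \<Rightarrow> real"
  reward :: "'i \<Rightarrow> real"
  duration :: real

definition omr_instance :: "'i omr \<Rightarrow> bool" where
  "omr_instance G \<longleftrightarrow>
     finite (resources G) \<and>
     edges G \<subseteq> resources G \<times> {..<num_arrivals G} \<and>
     mono_on {..<num_arrivals G} (arr_time G) \<and>
     (\<forall>i\<in>resources G. 0 \<le> reward G i) \<and>
     0 < duration G"

text \<open>
  \<open>M\<close> is the set of matches made before arrival \<open>t\<close>, so \<open>arr_time G s \<le> arr_time G t\<close> for all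
  \<open>(i, s) \<in> M\<close>. A match at \<open>s\<close> blocks the single unit of \<open>i\<close> up to and including time
  \<open>arr_time G s + duration G\<close>. In particular it blocks later arrivals at the same time as \<open>s\<close>.
\<close>

definition available :: "'i omr \<Rightarrow> ('i \<times> nat) set \<Rightarrow> nat \<Rightarrow> 'i \<Rightarrow> bool" where
  "available G M t i \<longleftrightarrow> (\<forall>s. (i, s) \<in> M \<longrightarrow> arr_time G s + duration G < arr_time G t)"

definition feasible_matching :: "'i omr \<Rightarrow> ('i \<times> nat) set \<Rightarrow> bool" where
  "feasible_matching G M \<longleftrightarrow>
     M \<subseteq> edges G \<and>
     (\<forall>i j t. (i, t) \<in> M \<and> (j, t) \<in> M \<longrightarrow> i = j) \<and>
     (\<forall>(i, t)\<in>M. available G {(j, s)\<in>M. s < t} t i)"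

definition total_reward :: "'i omr \<Rightarrow> ('i \<times> nat) set \<Rightarrow> real" where
  "total_reward G M = (\<Sum>(i, t)\<in>M. reward G i)"

definition Offline :: "'i omr \<Rightarrow> real" where
  "Offline G = Max (total_reward G ` {M. feasible_matching G M})"

definition g :: "real \<Rightarrow> real \<Rightarrow> real" where
  "g \<beta> x = exp (\<beta> * (x - 1))"

text \<open>Period \<open>k\<close> is the time interval \<open>[k d, (k + 1) d)\<close> for \<open>k :: int\<close>.\<close>

definition period :: "'i omr \<Rightarrow> nat \<Rightarrow> int" where
  "period G t = \<lfloor>arr_time G t / duration G\<rfloor>"

text \<open>\<open>y (k, i)\<close> is the seed of resource \<open>i\<close> drawn at the start of period \<open>k\<close>.\<close>

definition seeds :: "'i omr \<Rightarrow> (int \<times> 'i \<Rightarrow> real) measure" where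
  "seeds G = PiM (UNIV \<times> resources G) (\<lambda>_. uniform_measure lborel {0..1})"

text \<open>
  The matches made by Periodic Reranking on the first arrivals, where \<open>tie t S\<close> selects the
  resource for arrival \<open>t\<close> from the set \<open>S\<close> of maximizers.
\<close>

primrec periodic_reranking ::
  "real \<Rightarrow> (nat \<Rightarrow> 'i set \<Rightarrow> 'i) \<Rightarrow> 'i omr \<Rightarrow> (int \<times> 'i \<Rightarrow> real) \<Rightarrow> nat \<Rightarrow> ('i \<times> nat) set" where
  "periodic_reranking \<beta> tie G y 0 = {}"
| "periodic_reranking \<beta> tie G y (Suc t) =
     (let M = periodic_reranking \<beta> tie G y t;
          A = {i. (i, t) \<in> edges G \<and> available G M t i};
          S = {i. is_arg_max (\<lambda>i. reward G i * (1 - g \<beta> (y (period G t, i)))) (\<lambda>i. i \<in> A) i}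
      in if A = {} then M else insert (tie t S, t) M)"

definition expected_reward :: "real \<Rightarrow> (nat \<Rightarrow> 'i set \<Rightarrow> 'i) \<Rightarrow> 'i omr \<Rightarrow> real" where
  "expected_reward \<beta> tie G =
     (\<integral>y. total_reward G (periodic_reranking \<beta> tie G y (num_arrivals G)) \<partial>seeds G)"

end

theory Submission
  imports Defs
begin

text \<open>
  Fix an edge \<open>(i, t)\<close> of an optimal matching, with \<open>t\<close> in period \<open>k\<close>. A match of \<open>i\<close> with seed \<open>x\<close>
  pays \<open>r\<^sub>i (1 - g x)\<close> to the arrival and \<open>r\<^sub>i g x\<close> to at most one optimal edge \<open>(i, t)\<close>: either
  the one in the same period, if the match is not later than \<open>t\<close>, or the one in the next period, if
  the match still blocks \<open>i\<close> at \<open>t\<close>.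

  Fix all seeds except \<open>x\<close>, \<open>w\<close> of \<open>i\<close> in the periods \<open>k - 1\<close>, \<open>k\<close>. Let \<open>r\<^sub>i (1 - u)\<close> be what \<open>t\<close> is
  paid when \<open>i\<close> is removed from both periods. If \<open>i\<close> is not matched in period \<open>k - 1\<close>, then the
  usual analysis of ranking gives \<open>1 - u + (u - g 0) / \<beta>\<close> on average over \<open>w\<close>. If \<open>i\<close> is matched in
  period \<open>k - 1\<close> so late that it is blocked at \<open>t\<close>, then the other resources are no less available
  up to \<open>t\<close>, and the gain is at least \<open>1 - u + g x\<close>. If \<open>i\<close> is matched earlier in period \<open>k - 1\<close>,
  then the gain is at least \<open>1 - g 0\<close>, and this happens for an initial segment of the values of \<open>x\<close>.
  The worst case over \<open>u\<close> and over the segment is the smaller of \<open>1 - g 0\<close> and the integral of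
  \<open>min (g x) ((1 - g 0) / \<beta>)\<close>, which both exceed \<open>0.589\<close> for \<open>\<beta> = 0.89\<close>.
\<close>

section \<open>Measure-theoretic preliminaries\<close>

context product_prob_space
begin

lemma nn_integral_PiM_resample:
  assumes j: "j \<in> I" and f [measurable]: "f \<in> borel_measurable (PiM I M)"
  shows "(\<integral>\<^sup>+ y. \<integral>\<^sup>+ x. f (y(j := x)) \<partial>M j \<partial>PiM I M) = (\<integral>\<^sup>+ y. f y \<partial>PiM I M)"
    and "(\<lambda>y. \<integral>\<^sup>+ x. f (y(j := x)) \<partial>M j) \<in> borel_measurable (PiM I M)"
proof -
  have insert_j: "insert j I = I" using j by blast
  interpret JP: pair_sigma_finite "M j" "PiM I M" ..
  have upd [measurable]: "(\<lambda>(x, y). y(j := x)) \<in> measurable (M j \<Otimes>\<^sub>M PiM I M) (PiM I M)"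
    using measurable_add_dim[of j I M]
      measurable_compose[OF measurable_pair_swap', of "\<lambda>(f, y). f(j := y)"]
    by (simp add: insert_j case_prod_beta')
  have "distr (M j \<Otimes>\<^sub>M PiM I M) (PiM I M) (\<lambda>(x, y). y(j := x)) = PiM I M"
    using distr_pair_PiM_eq_PiM[of I M j] prob_space by (simp add: insert_j)
  then have "(\<integral>\<^sup>+ y. f y \<partial>PiM I M) =
      (\<integral>\<^sup>+ y. f y \<partial>distr (M j \<Otimes>\<^sub>M PiM I M) (PiM I M) (\<lambda>(x, y). y(j := x)))"
    by simp
  also have "\<dots> = (\<integral>\<^sup>+ (x, y). f (y(j := x)) \<partial>(M j \<Otimes>\<^sub>M PiM I M))"
    by (subst nn_integral_distr) (auto simp: case_prod_beta')
  also have "\<dots> = (\<integral>\<^sup>+ y. \<integral>\<^sup>+ x. f (y(j := x)) \<partial>M j \<partial>PiM I M)"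
    by (subst JP.nn_integral_snd[symmetric]) auto
  finally show "(\<integral>\<^sup>+ y. \<integral>\<^sup>+ x. f (y(j := x)) \<partial>M j \<partial>PiM I M) = (\<integral>\<^sup>+ y. f y \<partial>PiM I M)" ..
  have "(\<lambda>(y, x). f (y(j := x))) \<in> borel_measurable (PiM I M \<Otimes>\<^sub>M M j)"
    using measurable_compose[OF measurable_pair_swap' measurable_compose[OF upd f]]
    by (simp add: case_prod_beta')
  then show "(\<lambda>y. \<integral>\<^sup>+ x. f (y(j := x)) \<partial>M j) \<in> borel_measurable (PiM I M)"
    by (intro M.borel_measurable_nn_integral)
qed

lemma AE_PiM_resample:
  assumes "j \<in> I" and [measurable]: "Measurable.pred (PiM I M) P"
    and AE: "\<And>y. AE x in M j. P (y(j := x))"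
  shows "AE y in PiM I M. P y"
proof -
  let ?f = "\<lambda>y. if P y then 0 else 1 :: ennreal"
  have "(\<integral>\<^sup>+ x. ?f (y(j := x)) \<partial>M j) = (\<integral>\<^sup>+ x. 0 \<partial>M j)" for y
    using AE[of y] by (intro nn_integral_cong_AE) (auto elim: eventually_mono)
  then have "(\<integral>\<^sup>+ y. ?f y \<partial>PiM I M) = 0"
    using nn_integral_PiM_resample(1)[OF assms(1), of ?f] by simp
  then have "AE y in PiM I M. ?f y = 0"
    by (subst (asm) nn_integral_0_iff_AE) auto
  then show ?thesis by eventually_elim (simp split: if_splits)
qed

end

lemma measurable_if_finitely_determined:
  assumes "finite \<P>" and meas: "\<And>P. P \<in> \<P> \<Longrightarrow> Measurable.pred N P"
    and determined: "\<And>x y. x \<in> space N \<Longrightarrow> y \<in> space N \<Longrightarrow> (\<And>P. P \<in> \<P> \<Longrightarrow> P x = P y) \<Longrightarrow> f x = f y"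
  shows "f \<in> measurable N (count_space UNIV)"
proof (rule measurableI)
  fix B assume "B \<in> sets (count_space (UNIV :: 'b set))"
  let ?cell = "\<lambda>X. {y \<in> space N. \<forall>P\<in>\<P>. P y \<longleftrightarrow> P \<in> X}"
  let ?\<X> = "{X \<in> Pow \<P>. ?cell X \<inter> f -` B \<noteq> {}}"
  have "?cell X \<in> sets N" for X
    using assms(1) meas
    by (intro sets.sets_Collect_finite_All sets.sets_Collect) (auto simp: pred_def)
  then have "(\<Union>X\<in>?\<X>. ?cell X) \<in> sets N"
    using assms(1) by (intro sets.finite_UN) auto
  moreover have "f -` B \<inter> space N = (\<Union>X\<in>?\<X>. ?cell X)"
  proof (intro equalityI subsetI)
    fix y assume "y \<in> f -` B \<inter> space N"
    then show "y \<in> (\<Union>X\<in>?\<X>. ?cell X)" by (intro UN_I[of "{P \<in> \<P>. P y}"]) auto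
  next
    fix y assume "y \<in> (\<Union>X\<in>?\<X>. ?cell X)"
    then obtain X x where X: "y \<in> ?cell X" and x: "x \<in> ?cell X" "f x \<in> B" by blast
    then have "f y = f x" by (intro determined) auto
    with X x show "y \<in> f -` B \<inter> space N" by simp
  qed
  ultimately show "f -` B \<inter> space N \<in> sets N" by (simp only:)
qed simp

text \<open>
  If \<open>a \<le> h x\<close> outside of the initial segment, then \<open>a \<le> f\<close> everywhere. Otherwise \<open>h x < a \<le> b\<close> at
  some point outside of the initial segment, hence on the whole initial segment, and \<open>h \<le> f\<close>.
\<close>

lemma nn_integral_ge_if_initial_segment:
  fixes M :: "'a :: linorder measure"
  assumes "prob_space M"
    and initial: "\<And>x x'. S x \<Longrightarrow> x' < x \<Longrightarrow> S x'" and "mono h"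
    and in_segment: "\<And>x. S x \<Longrightarrow> b \<le> f x"
    and off_segment: "\<And>x. \<not> S x \<Longrightarrow> h x \<le> f x"
    and "a \<le> b" and h: "a \<le> (\<integral>\<^sup>+ x. h x \<partial>M)"
  shows "a \<le> (\<integral>\<^sup>+ x. f x \<partial>M)"
proof (cases "\<forall>x. \<not> S x \<longrightarrow> a \<le> h x")
  case True
  then have "a \<le> f x" for x
    using order_trans[OF \<open>a \<le> b\<close> in_segment[of x]] order_trans[OF _ off_segment[of x]] by blast
  then have "(\<integral>\<^sup>+ x. a \<partial>M) \<le> (\<integral>\<^sup>+ x. f x \<partial>M)" by (rule nn_integral_mono)
  then show ?thesis by (simp add: prob_space.emeasure_space_1[OF assms(1)])
next
  case False
  then obtain x0 where x0: "\<not> S x0" "h x0 < a" by (auto simp: not_le)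
  have "h x \<le> f x" for x
  proof (cases "S x")
    case True
    then have "x \<le> x0" using initial x0(1) not_less by blast
    then have "h x \<le> b" using monoD[OF \<open>mono h\<close>, of x x0] x0(2) \<open>a \<le> b\<close> by auto
    then show ?thesis using in_segment[OF True] by (rule order_trans)
  qed (rule off_segment)
  then have "(\<integral>\<^sup>+ x. h x \<partial>M) \<le> (\<integral>\<^sup>+ x. f x \<partial>M)" by (rule nn_integral_mono)
  with h show ?thesis by (rule order_trans)
qed

section \<open>Integrals over a uniform seed\<close>

abbreviation unif01 :: "real measure" where
  "unif01 \<equiv> uniform_measure lborel {0..1}"

interpretation unif01: prob_space unif01
  by (intro prob_space_uniform_measure) auto

lemma AE_unif01_not_eq: "AE x in unif01. x \<noteq> z"
  by (intro AE_uniform_measureI) (auto intro: eventually_mono[OF AE_lborel_singleton[of z]])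

lemma AE_unif01: "AE x in unif01. 0 \<le> x \<and> x < 1"
  by (intro AE_uniform_measureI) (auto intro: eventually_mono[OF AE_lborel_singleton[of 1]])

lemma emeasure_unif01_Ioc:
  assumes "0 \<le> p" "p \<le> 1"
  shows "emeasure unif01 {p<..1} = ennreal (1 - p)"
proof -
  have "{0..1} \<inter> {p<..1} = {p<..1}" using assms by auto
  with assms show ?thesis by (simp add: divide_ennreal_def)
qed

lemma g_mono: "0 < \<beta> \<Longrightarrow> x \<le> y \<Longrightarrow> g \<beta> x \<le> g \<beta> y"
  and g_strict_mono: "0 < \<beta> \<Longrightarrow> x < y \<Longrightarrow> g \<beta> x < g \<beta> y"
  and g_pos: "0 < g \<beta> x"
  and g_1: "g \<beta> 1 = 1"
  and g_0_less_1: "0 < \<beta> \<Longrightarrow> g \<beta> 0 < 1"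
  by (auto simp: g_def)

lemma g_nonneg: "0 \<le> g \<beta> x"
  using g_pos by (rule less_imp_le)

lemma g_onto:
  assumes "0 < \<beta>" "g \<beta> 0 < u" "u \<le> 1"
  obtains z where "0 \<le> z" "z \<le> 1" "g \<beta> z = u"
proof
  have "0 < u" using assms g_pos[of \<beta> 0] by linarith
  then show eq: "g \<beta> (1 + ln u / \<beta>) = u" using assms by (simp add: g_def)
  show "0 \<le> 1 + ln u / \<beta>"
    using assms eq g_strict_mono[of \<beta> "1 + ln u / \<beta>" 0] by (force simp: not_le[symmetric])
  show "1 + ln u / \<beta> \<le> 1" using assms \<open>0 < u\<close> by (simp add: divide_nonpos_pos)
qed

lemma borel_measurable_g [measurable]: "g \<beta> \<in> borel_measurable borel"
  unfolding g_def[abs_def] by measurable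

lemma nn_integral_g_Icc:
  assumes "0 < \<beta>" "0 \<le> p" "p \<le> 1"
  shows "(\<integral>\<^sup>+ x. ennreal (g \<beta> x) * indicator {0..p} x \<partial>unif01) = ennreal ((g \<beta> p - g \<beta> 0) / \<beta>)"
proof -
  have "(\<integral>\<^sup>+ x. ennreal (g \<beta> x) * indicator {0..p} x \<partial>unif01) =
      (\<integral>\<^sup>+ x. ennreal (g \<beta> x) * indicator {0..p} x \<partial>lborel)"
    using assms
    by (subst nn_integral_uniform_measure)
      (auto intro!: nn_integral_cong simp: divide_ennreal_def indicator_def)
  also have "\<dots> = ennreal (g \<beta> p / \<beta> - g \<beta> 0 / \<beta>)"
  proof (rule nn_integral_FTC_Icc)
    show "((\<lambda>x. g \<beta> x / \<beta>) has_real_derivative g \<beta> x) (at x)" for x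
      unfolding g_def using assms by (auto intro!: derivative_eq_intros)
  qed (use assms in \<open>auto simp: g_nonneg\<close>)
  finally show ?thesis by (simp add: diff_divide_distrib)
qed

definition g_mass_below :: "real \<Rightarrow> real \<Rightarrow> real" where
  "g_mass_below \<beta> u = max 0 ((u - g \<beta> 0) / \<beta>)"

lemma g_mass_below_nonneg: "0 \<le> g_mass_below \<beta> u"
  by (simp add: g_mass_below_def)

lemma g_mass_below_eq_0: "0 < \<beta> \<Longrightarrow> u \<le> g \<beta> 0 \<Longrightarrow> g_mass_below \<beta> u = 0"
  by (simp add: g_mass_below_def divide_nonpos_pos)

lemma g_mass_below_eq: "0 < \<beta> \<Longrightarrow> g \<beta> 0 \<le> u \<Longrightarrow> g_mass_below \<beta> u = (u - g \<beta> 0) / \<beta>"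
  by (simp add: g_mass_below_def)

lemma le_g_mass_below:
  assumes "0 < \<beta>" "\<beta> \<le> 1"
  shows "u - g \<beta> 0 \<le> g_mass_below \<beta> u"
proof (cases "u \<le> g \<beta> 0")
  case False
  then have "(u - g \<beta> 0) * \<beta> \<le> u - g \<beta> 0" using assms by (simp add: mult_left_le)
  then show ?thesis using False assms by (simp add: g_mass_below_eq pos_le_divide_eq)
qed (simp add: g_mass_below_def)

lemma nn_integral_g_below:
  assumes "0 < \<beta>" "u \<le> 1"
  shows "(\<integral>\<^sup>+ x. ennreal (if g \<beta> x < u then g \<beta> x else 0) \<partial>unif01) = ennreal (g_mass_below \<beta> u)"
proof (cases "u \<le> g \<beta> 0")
  case True
  have "AE x in unif01. ennreal (if g \<beta> x < u then g \<beta> x else 0) = 0"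
    using AE_unif01
  proof eventually_elim
    case (elim x)
    then show ?case using True g_mono[OF assms(1), of 0 x] by auto
  qed
  then have "(\<integral>\<^sup>+ x. ennreal (if g \<beta> x < u then g \<beta> x else 0) \<partial>unif01) = (\<integral>\<^sup>+ x. 0 \<partial>unif01)"
    by (rule nn_integral_cong_AE)
  with True assms show ?thesis by (simp add: g_mass_below_eq_0)
next
  case False
  then obtain z where z: "0 \<le> z" "z \<le> 1" "g \<beta> z = u" using g_onto[of \<beta> u] assms by auto
  have "AE x in unif01.
      ennreal (if g \<beta> x < u then g \<beta> x else 0) = ennreal (g \<beta> x) * indicator {0..z} x"
    using AE_unif01 AE_unif01_not_eq[of z]
  proof eventually_elim
    case (elim x)
    then show ?case
      using z g_strict_mono[OF assms(1), of x z] g_strict_mono[OF assms(1), of z x]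
      by (cases "x < z") auto
  qed
  then have "(\<integral>\<^sup>+ x. ennreal (if g \<beta> x < u then g \<beta> x else 0) \<partial>unif01) =
      (\<integral>\<^sup>+ x. ennreal (g \<beta> x) * indicator {0..z} x \<partial>unif01)"
    by (rule nn_integral_cong_AE)
  with False z assms show ?thesis by (simp add: nn_integral_g_Icc g_mass_below_eq)
qed

lemma integrable_min_g:
  assumes "0 < \<beta>"
  shows "integrable unif01 (\<lambda>x. min (g \<beta> x) c)"
proof (rule unif01.integrable_const_bound)
  show "AE x in unif01. norm (min (g \<beta> x) c) \<le> max 1 \<bar>c\<bar>"
    using AE_unif01
  proof eventually_elim
    case (elim x)
    then show ?case using g_mono[OF assms, of x 1] g_pos[of \<beta> x] by (auto simp: g_1)
  qed
qed measurable

definition competitive_ratio :: "real \<Rightarrow> real" where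
  "competitive_ratio \<beta> = min (1 - g \<beta> 0) (\<integral>x. min (g \<beta> x) (g_mass_below \<beta> 1) \<partial>unif01)"

lemma competitive_ratio_nonneg: "0 < \<beta> \<Longrightarrow> 0 \<le> competitive_ratio \<beta>"
  unfolding competitive_ratio_def using g_0_less_1[of \<beta>]
  by (auto intro!: Bochner_Integration.integral_nonneg simp: g_nonneg g_mass_below_nonneg)

text \<open>Concavity in \<open>u\<close> reduces the claim to \<open>u = g \<beta> 0\<close> and \<open>u = 1\<close>.\<close>

lemma competitive_ratio_le_integral:
  assumes \<beta>: "0 < \<beta>" and "u \<le> 1"
  shows "competitive_ratio \<beta> \<le> (\<integral>x. 1 - u + min (g \<beta> x) (g_mass_below \<beta> u) \<partial>unif01)"
proof (cases "u \<le> g \<beta> 0")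
  case True
  then have "(\<integral>x. 1 - u + min (g \<beta> x) (g_mass_below \<beta> u) \<partial>unif01) = 1 - u"
    using \<beta> unif01.prob_space by (simp add: g_mass_below_eq_0 min_absorb2 g_nonneg)
  then show ?thesis using True by (simp add: competitive_ratio_def)
next
  case False
  define s where "s = (u - g \<beta> 0) / (1 - g \<beta> 0)"
  have s: "0 \<le> s" "s \<le> 1" and u: "1 - u = (1 - s) * (1 - g \<beta> 0)"
    using False \<open>u \<le> 1\<close> g_0_less_1[OF \<beta>] by (auto simp: s_def field_simps)
  have mass: "g_mass_below \<beta> u = s * g_mass_below \<beta> 1"
    using False g_0_less_1[OF \<beta>] \<beta> by (simp add: g_mass_below_eq s_def)
  have "competitive_ratio \<beta> = (1 - s) * competitive_ratio \<beta> + s * competitive_ratio \<beta>"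
    by (simp add: algebra_simps)
  also have "\<dots> \<le> (1 - s) * (1 - g \<beta> 0) + s * (\<integral>x. min (g \<beta> x) (g_mass_below \<beta> 1) \<partial>unif01)"
    using s by (intro add_mono mult_left_mono) (auto simp: competitive_ratio_def)
  also have "\<dots> = (\<integral>x. 1 - u + s * min (g \<beta> x) (g_mass_below \<beta> 1) \<partial>unif01)"
    using integrable_min_g[OF \<beta>] unif01.prob_space by (simp add: u)
  also have "\<dots> \<le> (\<integral>x. 1 - u + min (g \<beta> x) (g_mass_below \<beta> u) \<partial>unif01)"
  proof (rule integral_mono)
    fix x
    have "s * min (g \<beta> x) (g_mass_below \<beta> 1) \<le> 1 * g \<beta> x"
      using s g_nonneg by (intro mult_mono) (auto simp: g_mass_below_nonneg)
    moreover have "s * min (g \<beta> x) (g_mass_below \<beta> 1) \<le> g_mass_below \<beta> u"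
      unfolding mass using s by (intro mult_left_mono) auto
    ultimately show "1 - u + s * min (g \<beta> x) (g_mass_below \<beta> 1) \<le>
        1 - u + min (g \<beta> x) (g_mass_below \<beta> u)"
      by simp
  qed (use integrable_min_g[OF \<beta>] in auto)
  finally show ?thesis .
qed

lemma competitive_ratio_le_nn_integral:
  assumes \<beta>: "0 < \<beta>" and "u \<le> 1" "0 \<le> r"
  shows "ennreal (competitive_ratio \<beta> * r) \<le>
    (\<integral>\<^sup>+ x. ennreal (r * (1 - u + min (g \<beta> x) (g_mass_below \<beta> u))) \<partial>unif01)"
proof -
  let ?h = "\<lambda>x. r * (1 - u + min (g \<beta> x) (g_mass_below \<beta> u))"
  have "ennreal (competitive_ratio \<beta> * r) \<le> ennreal (\<integral>x. ?h x \<partial>unif01)"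
    using competitive_ratio_le_integral[OF \<beta> \<open>u \<le> 1\<close>] \<open>0 \<le> r\<close>
    by (intro ennreal_leI) (simp add: mult.commute mult_left_mono)
  also have "\<dots> = (\<integral>\<^sup>+ x. ennreal (?h x) \<partial>unif01)"
    using integrable_min_g[OF \<beta>] \<open>u \<le> 1\<close> \<open>0 \<le> r\<close>
    by (intro nn_integral_eq_integral[symmetric] AE_I2) (auto simp: g_nonneg g_mass_below_nonneg)
  finally show ?thesis .
qed

lemma integral_min_g:
  assumes \<beta>: "0 < \<beta>" and p: "0 \<le> p" "p \<le> 1"
  shows "(\<integral>x. min (g \<beta> x) (g \<beta> p) \<partial>unif01) = (g \<beta> p - g \<beta> 0) / \<beta> + g \<beta> p * (1 - p)"
proof -
  have "AE x in unif01. ennreal (min (g \<beta> x) (g \<beta> p)) =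
      ennreal (g \<beta> x) * indicator {0..p} x + ennreal (g \<beta> p) * indicator {p<..1} x"
    using AE_unif01
  proof eventually_elim
    case (elim x)
    then show ?case
      using g_mono[OF \<beta>, of x p] g_mono[OF \<beta>, of p x]
      by (cases "x \<le> p") (auto simp: min_absorb1 min_absorb2)
  qed
  then have "(\<integral>\<^sup>+ x. ennreal (min (g \<beta> x) (g \<beta> p)) \<partial>unif01) =
      (\<integral>\<^sup>+ x. ennreal (g \<beta> x) * indicator {0..p} x + ennreal (g \<beta> p) * indicator {p<..1} x \<partial>unif01)"
    by (rule nn_integral_cong_AE)
  also have "\<dots> = ennreal ((g \<beta> p - g \<beta> 0) / \<beta>) + ennreal (g \<beta> p) * ennreal (1 - p)"
    using nn_integral_g_Icc[OF \<beta> p] p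
    by (simp add: nn_integral_add nn_integral_cmult_indicator emeasure_unif01_Ioc
        del: emeasure_uniform_measure)
  also have "\<dots> = ennreal ((g \<beta> p - g \<beta> 0) / \<beta> + g \<beta> p * (1 - p))"
    using p \<beta> g_mono[of \<beta> 0 p] by (simp add: ennreal_mult ennreal_plus g_nonneg)
  finally show ?thesis
    using p \<beta> g_mono[of \<beta> 0 p]
    by (intro has_bochner_integral_integral_eq has_bochner_integral_nn_integral)
      (auto simp: g_nonneg)
qed

lemma exp_nonpos_le_Taylor_sum:
  fixes x :: real
  assumes "x \<le> 0" "odd n"
  shows "exp x \<le> (\<Sum>m<n. x ^ m / fact m)"
proof -
  obtain t where t: "exp x = (\<Sum>m<n. x ^ m / fact m) + exp t / fact n * x ^ n"
    using Maclaurin_exp_le by blast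
  have "x ^ n \<le> 0" using assms by (simp add: power_le_zero_eq odd_pos)
  then have "exp t / fact n * x ^ n \<le> 0" by (intro mult_nonneg_nonpos) simp_all
  with t show ?thesis by linarith
qed

lemma Taylor_sum_le_exp:
  fixes x :: real
  assumes "even n"
  shows "(\<Sum>m<n. x ^ m / fact m) \<le> exp x"
proof -
  obtain t where "exp x = (\<Sum>m<n. x ^ m / fact m) + exp t / fact n * x ^ n"
    using Maclaurin_exp_le by blast
  then show ?thesis using assms by (simp add: zero_le_even_power)
qed

lemma g_0_89_bounds:
  "g 0.89 0 \<le> 0.41066" "0.66168 \<le> g 0.89 0.536" "g 0.89 0.536 \<le> 0.6617"
proof -
  have "exp (-0.89::real) \<le> (\<Sum>m<9. (-0.89) ^ m / fact m)"
    "exp (-0.41296::real) \<le> (\<Sum>m<9. (-0.41296) ^ m / fact m)"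
    by (rule exp_nonpos_le_Taylor_sum; simp)+
  moreover have "(\<Sum>m<8. (-0.41296) ^ m / fact m) \<le> exp (-0.41296::real)"
    by (rule Taylor_sum_le_exp) simp
  ultimately show "g 0.89 0 \<le> 0.41066" "0.66168 \<le> g 0.89 0.536" "g 0.89 0.536 \<le> 0.6617"
    by (simp_all add: g_def eval_nat_numeral)
qed

text \<open>\<open>0.536\<close> is slightly below the point where \<open>g 0.89\<close> reaches \<open>g_mass_below 0.89 1\<close>.\<close>

lemma competitive_ratio_0_89: "0.589 \<le> competitive_ratio 0.89"
proof -
  have "(0.589::real) \<le> (g 0.89 0.536 - g 0.89 0) / 0.89 + g 0.89 0.536 * (1 - 0.536)"
    using g_0_89_bounds by (simp add: field_simps)
  also have "\<dots> = (\<integral>x. min (g 0.89 x) (g 0.89 0.536) \<partial>unif01)"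
    by (rule integral_min_g[symmetric]) auto
  also have "\<dots> \<le> (\<integral>x. min (g 0.89 x) (g_mass_below 0.89 1) \<partial>unif01)"
  proof (intro integral_mono integrable_min_g)
    have "g 0.89 0.536 \<le> g_mass_below 0.89 1"
      using g_0_89_bounds by (simp add: g_mass_below_eq)
    then show "min (g 0.89 x) (g 0.89 0.536) \<le> min (g 0.89 x) (g_mass_below 0.89 1)" for x
      by auto
  qed auto
  finally show ?thesis
    using g_0_89_bounds(1) by (simp add: competitive_ratio_def)
qed

section \<open>Periods\<close>

locale reusable_resources =
  fixes G :: "'i omr"
  assumes instance_G: "omr_instance G"
begin

lemma finite_resources: "finite (resources G)"
  and edge_resource: "(i, t) \<in> edges G \<Longrightarrow> i \<in> resources G"
  and edge_arrival: "(i, t) \<in> edges G \<Longrightarrow> t < num_arrivals G"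
  and arr_time_mono: "s \<le> t \<Longrightarrow> t < num_arrivals G \<Longrightarrow> arr_time G s \<le> arr_time G t"
  and reward_nonneg: "i \<in> resources G \<Longrightarrow> 0 \<le> reward G i"
  and duration_pos: "0 < duration G"
  using instance_G by (auto simp: omr_instance_def mono_on_def)

lemma period_mono: "s \<le> t \<Longrightarrow> t < num_arrivals G \<Longrightarrow> period G s \<le> period G t"
  unfolding period_def using arr_time_mono duration_pos
  by (intro floor_mono divide_right_mono) auto

lemma less_if_period_less: "period G s < period G t \<Longrightarrow> s < num_arrivals G \<Longrightarrow> s < t"
  using period_mono[of t s] by (meson not_less)

lemma period_bounds:
  "of_int (period G t) * duration G \<le> arr_time G t"
  "arr_time G t < (of_int (period G t) + 1) * duration G"
proof -
  have "of_int (period G t) \<le> arr_time G t / duration G"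
    "arr_time G t / duration G < of_int (period G t) + 1"
    unfolding period_def by linarith+
  then show "of_int (period G t) * duration G \<le> arr_time G t"
    "arr_time G t < (of_int (period G t) + 1) * duration G"
    using duration_pos by (auto simp: pos_le_divide_eq pos_divide_less_eq)
qed

definition blocks :: "nat \<Rightarrow> nat \<Rightarrow> bool" where
  "blocks s t \<longleftrightarrow> arr_time G t \<le> arr_time G s + duration G"

lemma blocks_if_same_period:
  assumes "period G s = period G t"
  shows "blocks s t"
  using period_bounds(1)[of s] period_bounds(2)[of t] assms by (simp add: blocks_def algebra_simps)

lemma period_le_if_blocks:
  assumes "blocks s t"
  shows "period G t \<le> period G s + 1"
proof -
  have "of_int (period G t) * duration G < (of_int (period G s) + 2) * duration G"
    using assms period_bounds(1)[of t] period_bounds(2)[of s]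
    by (simp add: blocks_def algebra_simps)
  then have "(of_int (period G t) :: real) < of_int (period G s) + 2"
    using duration_pos by (simp add: mult_less_cancel_right)
  then show ?thesis by linarith
qed

lemma blocks_later: "blocks s t \<Longrightarrow> s \<le> s' \<Longrightarrow> s' < num_arrivals G \<Longrightarrow> blocks s' t"
  using arr_time_mono[of s s'] by (simp add: blocks_def)

lemma blocks_earlier: "blocks s t \<Longrightarrow> t' \<le> t \<Longrightarrow> t < num_arrivals G \<Longrightarrow> blocks s t'"
  using arr_time_mono[of t' t] by (simp add: blocks_def)

section \<open>The greedy matching for arbitrary prices\<close>

definition free :: "('i \<times> nat) set \<Rightarrow> nat \<Rightarrow> 'i set" where
  "free M t = {i. (i, t) \<in> edges G \<and> available G M t i}"

lemma free_subset: "free M t \<subseteq> resources G"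
  by (auto simp: free_def edge_resource)

definition maximizers :: "('i \<Rightarrow> real) \<Rightarrow> 'i set \<Rightarrow> 'i set" where
  "maximizers f A = {i \<in> A. \<forall>j\<in>A. f j \<le> f i}"

lemma maximizers_nonempty:
  assumes "A \<subseteq> resources G" "A \<noteq> {}"
  shows "maximizers f A \<noteq> {}"
proof -
  have "finite A" using assms(1) finite_resources by (rule finite_subset)
  with assms(2) have "Max (f ` A) \<in> f ` A" by (intro Max_in) auto
  then obtain i where "i \<in> A" "f i = Max (f ` A)" by force
  then have "i \<in> maximizers f A" using \<open>finite A\<close> by (simp add: maximizers_def)
  then show ?thesis by blast
qed

lemma maximizers_cong:
  assumes "\<And>i j. i \<in> A \<Longrightarrow> j \<in> A \<Longrightarrow> f i \<le> f j \<longleftrightarrow> f' i \<le> f' j"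
  shows "maximizers f A = maximizers f' A"
  using assms by (simp add: maximizers_def cong: conj_cong)

text \<open>
  Ties are broken by a fixed ranking of the resources, so that the comparisons of runs below hold
  for all prices and not only for generic ones.
\<close>

definition best :: "('i \<Rightarrow> real) \<Rightarrow> 'i set \<Rightarrow> 'i \<Rightarrow> bool" where
  "best f A i \<longleftrightarrow> i \<in> maximizers f A \<and>
    (\<forall>j\<in>maximizers f A. to_nat_on (resources G) i \<le> to_nat_on (resources G) j)"

lemma best_in: "best f A i \<Longrightarrow> i \<in> A"
  and best_ge: "best f A i \<Longrightarrow> j \<in> A \<Longrightarrow> f j \<le> f i"
  by (simp_all add: best_def maximizers_def)

lemma best_unique:
  assumes "best f A i" "best f A j" "A \<subseteq> resources G"
  shows "i = j"
proof -
  have "to_nat_on (resources G) i = to_nat_on (resources G) j"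
    using assms(1,2) by (intro order_antisym) (simp_all add: best_def)
  then show ?thesis
    using assms finite_resources best_in by (simp add: countable_finite subset_iff)
qed

lemma best_exists:
  assumes "A \<subseteq> resources G" "A \<noteq> {}"
  shows "\<exists>i. best f A i"
proof -
  obtain i where "i \<in> maximizers f A" using maximizers_nonempty[OF assms] by blast
  then show ?thesis
    using ex_has_least_nat[of "\<lambda>i. i \<in> maximizers f A" i "to_nat_on (resources G)"]
    by (auto simp: best_def)
qed

lemma best_cong:
  assumes "\<And>i j. i \<in> A \<Longrightarrow> j \<in> A \<Longrightarrow> f i \<le> f j \<longleftrightarrow> f' i \<le> f' j"
  shows "best f A = best f' A"
proof -
  have "maximizers f A = maximizers f' A" using assms by (rule maximizers_cong)
  then show ?thesis by (simp add: best_def fun_eq_iff)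
qed

lemma best_mono:
  assumes best: "best f A i" and "i \<in> B" "B \<subseteq> A"
    and i_le: "f i \<le> f' i" and le: "\<And>j. j \<in> B \<Longrightarrow> j \<noteq> i \<Longrightarrow> f' j \<le> f j"
  shows "best f' B i"
proof -
  have f'_le: "f' j \<le> f' i" if "j \<in> B" for j
    using best_ge[OF best, of j] le[OF that] that \<open>B \<subseteq> A\<close> i_le by (cases "j = i") auto
  have "to_nat_on (resources G) i \<le> to_nat_on (resources G) j" if j: "j \<in> maximizers f' B" for j
  proof (cases "j = i")
    case False
    have "j \<in> B" "f' i \<le> f' j" using j \<open>i \<in> B\<close> by (simp_all add: maximizers_def)
    then have "f i \<le> f j" using le[OF \<open>j \<in> B\<close> False] i_le by linarith
    then have "j \<in> maximizers f A"
      using best \<open>j \<in> B\<close> \<open>B \<subseteq> A\<close> by (auto simp: best_def maximizers_def intro: order_trans)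
    then show ?thesis using best by (simp add: best_def)
  qed simp
  then show ?thesis using f'_le \<open>i \<in> B\<close> by (simp add: best_def maximizers_def)
qed

lemma best_Diff:
  assumes "A \<subseteq> resources G" "\<not> best f A i"
  shows "best f (A - {i}) = best f A"
proof -
  have best_A: "best f (A - {i}) j" if "best f A j" for j
    using that assms(2) best_in[OF that] by (intro best_mono[OF that]) auto
  show ?thesis
  proof (intro ext iffI)
    fix j assume j: "best f (A - {i}) j"
    then obtain j' where j': "best f A j'" using best_exists[OF assms(1)] best_in by blast
    with best_A[OF j'] j best_unique[of f "A - {i}"] assms(1) show "best f A j" by blast
  qed (rule best_A)
qed

text \<open>A resource of nonpositive price is never matched, so that setting a price to \<open>0\<close> removes it.\<close>

primrec greedy :: "(nat \<Rightarrow> 'i \<Rightarrow> real) \<Rightarrow> nat \<Rightarrow> ('i \<times> nat) set" where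
  "greedy v 0 = {}"
| "greedy v (Suc t) =
     greedy v t \<union> {i. best (v t) {i \<in> free (greedy v t) t. 0 < v t i} i} \<times> {t}"

definition candidates :: "(nat \<Rightarrow> 'i \<Rightarrow> real) \<Rightarrow> nat \<Rightarrow> 'i set" where
  "candidates v t = {i \<in> free (greedy v t) t. 0 < v t i}"

definition matched :: "(nat \<Rightarrow> 'i \<Rightarrow> real) \<Rightarrow> nat \<Rightarrow> 'i \<Rightarrow> bool" where
  "matched v t = best (v t) (candidates v t)"

lemma greedy_Suc: "greedy v (Suc t) = greedy v t \<union> {i. matched v t i} \<times> {t}"
  by (simp add: matched_def candidates_def)

lemma mem_greedy: "(i, s) \<in> greedy v t \<longleftrightarrow> s < t \<and> matched v s i"
  by (induction t) (auto simp: greedy_Suc less_Suc_eq simp del: greedy.simps(2))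

lemma mem_candidates:
  "i \<in> candidates v t \<longleftrightarrow> (i, t) \<in> edges G \<and> available G (greedy v t) t i \<and> 0 < v t i"
  by (simp add: candidates_def free_def)

lemma candidates_subset: "candidates v t \<subseteq> resources G"
  using free_subset by (auto simp: candidates_def)

lemma matched_candidate: "matched v t i \<Longrightarrow> i \<in> candidates v t"
  unfolding matched_def by (rule best_in)

lemma matched_exists: "candidates v t \<noteq> {} \<Longrightarrow> \<exists>i. matched v t i"
  unfolding matched_def by (rule best_exists[OF candidates_subset])

lemma matched_unique: "matched v t i \<Longrightarrow> matched v t j \<Longrightarrow> i = j"
  unfolding matched_def by (rule best_unique[OF _ _ candidates_subset])

lemma matched_resource: "matched v t i \<Longrightarrow> i \<in> resources G"
  using matched_candidate candidates_subset by blast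

lemma matched_arrival: "matched v t i \<Longrightarrow> t < num_arrivals G"
  by (drule matched_candidate) (auto simp: mem_candidates intro: edge_arrival)

lemma matched_cong:
  assumes "greedy v t = greedy w t" "\<And>i. v t i = w t i"
  shows "matched v t = matched w t"
proof -
  have "v t = w t" using assms(2) by (rule ext)
  with assms(1) show ?thesis by (simp add: matched_def candidates_def)
qed

lemma greedy_subset: "greedy v t \<subseteq> resources G \<times> {..<t}"
  by (auto simp: mem_greedy intro: matched_resource)

lemma greedy_order_cong:
  assumes "\<And>s i. s < t \<Longrightarrow> i \<in> resources G \<Longrightarrow> 0 < v s i \<longleftrightarrow> 0 < w s i"
    and "\<And>s i j. s < t \<Longrightarrow> i \<in> resources G \<Longrightarrow> j \<in> resources G \<Longrightarrow>
      v s i \<le> v s j \<longleftrightarrow> w s i \<le> w s j"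
  shows "greedy v t = greedy w t"
  using assms
proof (induction t)
  case (Suc t)
  have IH: "greedy v t = greedy w t" by (rule Suc.IH) (use Suc.prems in simp_all)
  then have "candidates v t = candidates w t"
    using Suc.prems(1)[of t] edge_resource by (auto simp: mem_candidates)
  moreover have "best (v t) (candidates w t) = best (w t) (candidates w t)"
    using Suc.prems(2)[of t] candidates_subset by (intro best_cong) blast
  ultimately show ?case by (simp only: greedy_Suc IH matched_def)
qed simp

lemma finite_greedy: "finite (greedy v t)"
  using finite_subset[OF greedy_subset] finite_resources by blast

lemma not_available_greedy_iff:
  "\<not> available G (greedy v t) t i \<longleftrightarrow> (\<exists>s<t. matched v s i \<and> blocks s t)"
  by (auto simp: available_def mem_greedy blocks_def not_less)

lemma matched_not_blocks:
  assumes "matched v s i" "matched v t i" "s < t"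
  shows "\<not> blocks s t"
  using matched_candidate[OF assms(2)] not_available_greedy_iff[of v t i] assms(1,3)
  by (auto simp: mem_candidates)

lemma matched_once_per_period:
  assumes "matched v s i" "matched v t i" "period G s = period G t"
  shows "s = t"
proof (cases s t rule: linorder_cases)
  case less
  then show ?thesis
    using matched_not_blocks[OF assms(1,2)] blocks_if_same_period[OF assms(3)] by simp
next
  case greater
  then show ?thesis
    using matched_not_blocks[OF assms(2,1)] blocks_if_same_period[OF assms(3)[symmetric]] by simp
qed simp

definition carried_over :: "(nat \<Rightarrow> 'i \<Rightarrow> real) \<Rightarrow> nat \<Rightarrow> 'i set" where
  "carried_over v t = {i. \<exists>s. period G s < period G t \<and> matched v s i \<and>
    blocks s t}"

lemma carried_over_not_available:
  assumes "i \<in> carried_over v t"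
  shows "\<not> available G (greedy v t) t i"
  unfolding not_available_greedy_iff
  using assms less_if_period_less matched_arrival by (fastforce simp: carried_over_def)

lemma matched_same_period_not_available:
  assumes "s < t" "period G s = period G t" "matched v s i"
  shows "\<not> available G (greedy v t) t i"
  unfolding not_available_greedy_iff
  using assms blocks_if_same_period[OF assms(2)] by auto

lemma not_available_cases:
  assumes "\<not> available G (greedy v t) t i" "t < num_arrivals G"
  obtains (carried_over) "i \<in> carried_over v t"
    | (same_period) s where "s < t" "period G s = period G t" "matched v s i"
proof -
  obtain s where s: "s < t" "matched v s i" "blocks s t"
    using assms(1) unfolding not_available_greedy_iff by blast
  have "period G s \<le> period G t" using period_mono s(1) assms(2) by simp
  then consider "period G s < period G t" | "period G s = period G t" by linarith
  then show thesis by cases (use s that in \<open>auto simp: carried_over_def\<close>)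
qed

lemma carried_over_previous_period:
  assumes "i \<in> carried_over v t"
  obtains s where "period G s = period G t - 1" "matched v s i"
    "blocks s t"
proof -
  obtain s where s: "period G s < period G t" "matched v s i"
      "blocks s t"
    using assms by (auto simp: carried_over_def)
  with period_le_if_blocks[OF s(3)] that[of s] show thesis by simp
qed

definition returned :: "(nat \<Rightarrow> 'i \<Rightarrow> real) \<Rightarrow> 'i \<Rightarrow> nat \<Rightarrow> bool" where
  "returned v i t \<longleftrightarrow> (\<exists>s. period G s = period G t - 1 \<and> matched v s i \<and>
    \<not> blocks s t)"

lemma returned_not_carried_over:
  assumes "returned v i t"
  shows "i \<notin> carried_over v t"
proof
  obtain s where s: "period G s = period G t - 1" "matched v s i"
      "\<not> blocks s t"
    using assms by (auto simp: returned_def)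
  assume "i \<in> carried_over v t"
  then obtain s' where "period G s' = period G t - 1" "matched v s' i"
      "blocks s' t"
    by (rule carried_over_previous_period)
  with s matched_once_per_period[of v s i s'] show False by auto
qed

lemma matched_previous_period_cases:
  assumes "matched v s i" "period G s = period G t - 1"
  shows "returned v i t \<or> i \<in> carried_over v t"
  using assms by (fastforce simp: returned_def carried_over_def)

section \<open>What an arrival is paid\<close>

definition utility :: "(nat \<Rightarrow> 'i \<Rightarrow> real) \<Rightarrow> nat \<Rightarrow> real" where
  "utility v t = (\<Sum>i | matched v t i. v t i)"

lemma utility_matched:
  assumes "matched v t i"
  shows "utility v t = v t i"
proof -
  have "{j. matched v t j} = {i}" using assms matched_unique by blast
  then show ?thesis by (simp add: utility_def)
qed

lemma utility_nonneg: "0 \<le> utility v t"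
  unfolding utility_def using matched_candidate
  by (intro sum_nonneg) (auto simp: mem_candidates intro: less_imp_le)

lemma candidate_le_utility:
  assumes "i \<in> candidates v t"
  shows "v t i \<le> utility v t"
proof -
  obtain j where j: "matched v t j" using assms matched_exists by blast
  then show ?thesis using best_ge[OF j[unfolded matched_def] assms] by (simp add: utility_matched)
qed

lemma utility_mono:
  assumes "candidates w t \<subseteq> candidates v t" "\<And>i. i \<in> candidates w t \<Longrightarrow> w t i \<le> v t i"
  shows "utility w t \<le> utility v t"
proof (cases "\<exists>i. matched w t i")
  case True
  then obtain i where i: "matched w t i" ..
  then have "i \<in> candidates w t" by (rule matched_candidate)
  then show ?thesis
    using assms candidate_le_utility[of i v t] by (force simp: utility_matched[OF i])
next
  case False
  then show ?thesis using utility_nonneg by (simp add: utility_def)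
qed

lemma utility_cong:
  assumes "greedy v t = greedy w t" "\<And>i. v t i = w t i"
  shows "utility v t = utility w t"
  unfolding utility_def matched_cong[OF assms] by (simp add: assms(2))

lemma sum_utility: "(\<Sum>t<n. utility v t) = (\<Sum>(i, t)\<in>greedy v n. v t i)"
proof (induction n)
  case (Suc n)
  have "(\<Sum>(i, t)\<in>{i. matched v n i} \<times> {n}. v t i) = utility v n"
    by (simp add: sum.cartesian_product[symmetric] utility_def)
  moreover have "finite {i. matched v n i}"
    using finite_resources matched_resource by (auto intro: finite_subset)
  moreover have "greedy v n \<inter> {i. matched v n i} \<times> {n} = {}" by (auto simp: mem_greedy)
  ultimately show ?case
    using Suc finite_greedy by (simp add: greedy_Suc sum.union_disjoint del: greedy.simps(2))
qed simp

section \<open>Changing the price of a resource in one period\<close>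

definition reprice :: "(nat \<Rightarrow> 'i \<Rightarrow> real) \<Rightarrow> int \<Rightarrow> 'i \<Rightarrow> real \<Rightarrow> nat \<Rightarrow> 'i \<Rightarrow> real" where
  "reprice v k i p t j = (if period G t = k \<and> j = i then p else v t j)"

abbreviation remove :: "(nat \<Rightarrow> 'i \<Rightarrow> real) \<Rightarrow> int \<Rightarrow> 'i \<Rightarrow> nat \<Rightarrow> 'i \<Rightarrow> real" where
  "remove v k i \<equiv> reprice v k i 0"

lemma reprice_same: "period G t = k \<Longrightarrow> reprice v k i p t i = p"
  and reprice_other: "period G t \<noteq> k \<or> j \<noteq> i \<Longrightarrow> reprice v k i p t j = v t j"
  by (auto simp: reprice_def)

lemma reprice_reprice [simp]: "reprice (reprice v k i p) k i q = reprice v k i q"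
  by (auto simp: reprice_def fun_eq_iff)

lemma reprice_commute:
  "k \<noteq> l \<Longrightarrow> reprice (reprice v k i p) l j q = reprice (reprice v l j q) k i p"
  by (auto simp: reprice_def fun_eq_iff)

lemma candidates_remove:
  assumes "greedy (remove v k i) t = greedy v t" "period G t = k"
  shows "candidates (remove v k i) t = candidates v t - {i}"
  using assms by (auto simp: mem_candidates reprice_def split: if_splits)

lemma matched_remove:
  assumes greedy: "greedy (remove v k i) t = greedy v t"
    and "\<not> (period G t = k \<and> matched v t i)"
  shows "matched (remove v k i) t = matched v t"
proof (cases "period G t = k")
  case True
  have "matched (remove v k i) t = best (v t) (candidates v t - {i})"
    unfolding matched_def candidates_remove[OF greedy True]
    by (rule best_cong) (simp add: reprice_other)
  also have "\<dots> = matched v t"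
    unfolding matched_def using assms(2) True
    by (intro best_Diff candidates_subset) (simp add: matched_def)
  finally show ?thesis .
next
  case False
  then show ?thesis using greedy by (intro matched_cong) (simp_all add: reprice_other)
qed

lemma greedy_remove:
  assumes "\<And>s. s < t \<Longrightarrow> period G s = k \<Longrightarrow> \<not> matched v s i"
  shows "greedy (remove v k i) t = greedy v t"
  using assms
proof (induction t)
  case (Suc t)
  have IH: "greedy (remove v k i) t = greedy v t" by (rule Suc.IH) (use Suc.prems in simp)
  have "matched (remove v k i) t = matched v t"
    by (rule matched_remove[OF IH]) (use Suc.prems in simp)
  then show ?case by (simp only: greedy_Suc IH)
qed simp

lemma greedy_reprice:
  assumes "\<And>s. s < t \<Longrightarrow> period G s \<noteq> k"
  shows "greedy (reprice v k i p) t = greedy v t"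
proof -
  have "greedy (remove (reprice v k i p) k i) t = greedy (reprice v k i p) t"
    "greedy (remove v k i) t = greedy v t"
    by (rule greedy_remove; use assms in blast)+
  then show ?thesis by simp
qed

lemma matched_reprice_later_period:
  assumes "period G t < k"
  shows "matched (reprice v k i p) t = matched v t"
proof (cases "t < num_arrivals G")
  case True
  have "greedy (reprice v k i p) t = greedy v t"
    using assms period_mono[OF _ True] by (intro greedy_reprice) (meson less_imp_le not_less)
  then show ?thesis using assms by (intro matched_cong) (simp_all add: reprice_other)
next
  case False
  then show ?thesis using matched_arrival by (auto simp: fun_eq_iff)
qed

lemma carried_over_reprice:
  assumes "period G t \<le> k"
  shows "carried_over (reprice v k i p) t = carried_over v t"
  using assms by (auto simp: carried_over_def matched_reprice_later_period)

lemma utility_remove_unmatched: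
  assumes "\<And>s. period G s = k \<Longrightarrow> \<not> matched v s i" "period G t \<noteq> k"
  shows "utility (remove v k i) t = utility v t"
proof (rule utility_cong)
  show "greedy (remove v k i) t = greedy v t"
    by (rule greedy_remove) (rule assms(1))
qed (use assms(2) in \<open>simp add: reprice_other\<close>)

lemma matched_raise:
  assumes m: "matched (reprice v k i p) s i" and s: "period G s = k" and "p \<le> q"
  shows "\<exists>s'\<le>s. period G s' = k \<and> matched (reprice v k i q) s' i"
proof (rule ccontr)
  assume unmatched: "\<not> ?thesis"
  let ?v = "reprice v k i p" and ?w = "reprice v k i q"
  have "greedy (remove ?v k i) s = greedy ?v s"
  proof (rule greedy_remove)
    show "\<not> matched ?v s' i" if "s' < s" "period G s' = k" for s'
      using matched_once_per_period[OF _ m, of s'] s that by auto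
  qed
  moreover have "greedy (remove ?w k i) s = greedy ?w s"
    by (rule greedy_remove) (use unmatched in auto)
  ultimately have "greedy ?w s = greedy ?v s" by simp
  moreover have "0 < p" using matched_candidate[OF m] s by (simp add: mem_candidates reprice_same)
  ultimately have "candidates ?w s = candidates ?v s"
    using \<open>p \<le> q\<close> by (auto simp: mem_candidates reprice_def)
  moreover have "best (?w s) (candidates ?v s) i"
    using matched_candidate[OF m] \<open>p \<le> q\<close> s
    by (intro best_mono[OF m[unfolded matched_def]]) (auto simp: reprice_same reprice_other)
  ultimately have "matched ?w s i" by (simp add: matched_def)
  then show False using unmatched s by blast
qed

lemma returned_raise:
  assumes "returned (reprice v (period G t - 1) i p) i t" "p \<le> q"
  shows "returned (reprice v (period G t - 1) i q) i t"
proof -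
  obtain s where s: "period G s = period G t - 1" "matched (reprice v (period G t - 1) i p) s i"
      "\<not> blocks s t"
    using assms(1) by (auto simp: returned_def)
  obtain s' where s': "s' \<le> s" "period G s' = period G t - 1"
      "matched (reprice v (period G t - 1) i q) s' i"
    using matched_raise[OF s(2,1) assms(2)] by blast
  have "\<not> blocks s' t" using blocks_later[OF _ s'(1) matched_arrival[OF s(2)]] s(3) by blast
  with s' show ?thesis by (auto simp: returned_def)
qed

section \<open>Comparison of two runs\<close>

lemma not_available_transfer:
  assumes s: "s < t" "period G s = period G t" "t < num_arrivals G" and m: "matched v s i"
    and sub: "candidates w s \<subseteq> candidates v s"
    and agree: "\<And>j. j \<in> insert i (candidates w s) \<Longrightarrow> v s j = w s j"
    and persist: "i \<in> carried_over w s \<Longrightarrow> i \<notin> carried_over v s \<Longrightarrow> i \<in> carried_over w t"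
  shows "\<not> available G (greedy w t) t i"
proof (cases "i \<in> candidates w s")
  case True
  then have "matched w s i"
    unfolding matched_def
    by (rule best_mono[OF m[unfolded matched_def] _ sub]) (simp_all add: agree)
  then show ?thesis by (rule matched_same_period_not_available[OF s(1,2)])
next
  case False
  have i: "i \<in> candidates v s" using m by (rule matched_candidate)
  then have "\<not> available G (greedy w s) s i"
    using False agree[of i] by (simp add: mem_candidates)
  moreover have "s < num_arrivals G" using s by simp
  ultimately show ?thesis
  proof (cases rule: not_available_cases)
    case carried_over
    moreover have "i \<notin> carried_over v s"
      using i carried_over_not_available[of i v s] by (auto simp: mem_candidates)
    ultimately have "i \<in> carried_over w t" by (rule persist)
    then show ?thesis by (rule carried_over_not_available)
  next
    case (same_period s')
    then show ?thesis using matched_same_period_not_available[of s' t] s by simp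
  qed
qed

lemma available_transfer:
  assumes available: "available G (greedy w t) t i" and t: "t < num_arrivals G"
    and "i \<in> carried_over v t \<Longrightarrow> i \<in> carried_over w t"
    and sub: "\<And>s. s < t \<Longrightarrow> period G s = period G t \<Longrightarrow> candidates w s \<subseteq> candidates v s"
    and agree: "\<And>s j. period G s = period G t \<Longrightarrow> j \<in> insert i (candidates w s) \<Longrightarrow> v s j = w s j"
    and persist: "\<And>s. s < t \<Longrightarrow> period G s = period G t \<Longrightarrow>
      i \<in> carried_over w s \<Longrightarrow> i \<notin> carried_over v s \<Longrightarrow> i \<in> carried_over w t"
  shows "available G (greedy v t) t i"
proof (rule ccontr)
  assume "\<not> ?thesis"
  then show False using t
  proof (cases rule: not_available_cases)
    case carried_over
    then show False using assms(3) carried_over_not_available[of i w t] available by blast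
  next
    case (same_period s)
    have "\<not> available G (greedy w t) t i"
      using same_period t sub agree persist
      by (intro not_available_transfer[of s t v i w]) blast+
    then show False using available by blast
  qed
qed

text \<open>
  Without the last assumption on \<open>carried_over\<close>, the run for \<open>v\<close> could use up a resource before the
  resource returns in the run for \<open>w\<close>.
\<close>

lemma candidates_mono:
  assumes removed: "\<And>s. period G s = k \<Longrightarrow> w s i \<le> 0"
    and agree: "\<And>s j. period G s = k \<Longrightarrow> j \<noteq> i \<Longrightarrow> v s j = w s j"
    and incl: "\<And>s. s \<le> T \<Longrightarrow> period G s = k \<Longrightarrow> carried_over v s - {i} \<subseteq> carried_over w s"
    and persist: "\<And>s t. s \<le> t \<Longrightarrow> t \<le> T \<Longrightarrow> period G s = k \<Longrightarrow> period G t = k \<Longrightarrow>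
      carried_over w s - carried_over v s \<subseteq> carried_over w t"
    and T: "T < num_arrivals G"
  shows "t \<le> T \<Longrightarrow> period G t = k \<Longrightarrow> candidates w t \<subseteq> candidates v t"
proof (induction t rule: less_induct)
  case (less t)
  have not_i: "i \<notin> candidates w s" if "period G s = k" for s
    using removed[OF that] by (auto simp: mem_candidates)
  show ?case
  proof
    fix j assume j: "j \<in> candidates w t"
    then have "j \<noteq> i" using not_i less.prems by blast
    have "available G (greedy v t) t j"
    proof (rule available_transfer)
      show "available G (greedy w t) t j" using j by (simp add: mem_candidates)
      show "t < num_arrivals G" using less.prems T by simp
      show "j \<in> carried_over w t" if "j \<in> carried_over v t"
        using that incl[of t] less.prems \<open>j \<noteq> i\<close> by blast
      show "candidates w s \<subseteq> candidates v s" if "s < t" "period G s = period G t" for s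
        using that less.IH less.prems by simp
      show "v s l = w s l" if "period G s = period G t" "l \<in> insert j (candidates w s)" for s l
        using that agree[of s l] not_i[of s] less.prems(2) \<open>j \<noteq> i\<close> by fastforce
      show "j \<in> carried_over w t"
        if "s < t" "period G s = period G t" "j \<in> carried_over w s" "j \<notin> carried_over v s" for s
        using that persist[of s t] less.prems by (simp add: subset_iff)
    qed
    then show "j \<in> candidates v t"
      using j agree[of t j] less.prems \<open>j \<noteq> i\<close> by (simp add: mem_candidates)
  qed
qed

lemma candidates_remove_subset:
  assumes "period G t = k" "t < num_arrivals G"
  shows "candidates (remove v k i) t \<subseteq> candidates v t"
  using assms
  by (intro candidates_mono[where k = k and i = i and T = t])
    (simp_all add: reprice_same reprice_other carried_over_reprice)

lemma utility_remove_le: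
  assumes "period G t = k" "t < num_arrivals G"
  shows "utility (remove v k i) t \<le> utility v t"
proof (rule utility_mono[OF candidates_remove_subset[OF assms]])
  fix j assume "j \<in> candidates (remove v k i) t"
  then show "remove v k i t j \<le> v t j"
    using assms(1) by (cases "j = i") (auto simp: mem_candidates reprice_def)
qed

lemma matched_if_utility_remove_less:
  assumes edge: "(i, t) \<in> edges G" and "i \<notin> carried_over v t"
    and less: "utility (remove v (period G t) i) t < v t i"
  shows "\<exists>s\<le>t. period G s = period G t \<and> matched v s i"
proof (rule ccontr)
  assume unmatched: "\<not> ?thesis"
  let ?w = "remove v (period G t) i"
  have "available G (greedy v t) t i"
  proof (rule ccontr)
    assume "\<not> ?thesis"
    then show False using edge_arrival[OF edge]
      by (rule not_available_cases) (use unmatched assms(2) in \<open>auto intro: less_imp_le\<close>)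
  qed
  moreover have "0 < v t i" using utility_nonneg less by (rule le_less_trans)
  ultimately have i: "i \<in> candidates v t" using edge by (simp add: mem_candidates)
  then obtain j where j: "matched v t j" using matched_exists by blast
  have "j \<noteq> i" using unmatched j by blast
  have "greedy ?w t = greedy v t" by (rule greedy_remove) (use unmatched in auto)
  then have "matched ?w t j" using matched_remove[of v _ i t] unmatched j by auto
  then have "utility ?w t = v t j" using \<open>j \<noteq> i\<close> by (simp add: utility_matched reprice_other)
  also have "v t i \<le> \<dots>" using candidate_le_utility[OF i] utility_matched[OF j] by simp
  finally show False using less by simp
qed

section \<open>Removal of a resource from the previous period\<close>

lemma matched_remove_before:
  assumes "matched v b i" "period G b = k" "s < b"
  shows "matched (remove v k i) s = matched v s"
  using matched_once_per_period[OF assms(1)] assms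
  by (intro matched_remove greedy_remove) (metis less_irrefl less_trans)+

lemma matched_remove_other:
  assumes m: "matched v s j" and s: "period G s = k" and "j \<noteq> i"
  shows "\<exists>s'. period G s' = k \<and> matched (remove v k i) s' j"
proof (cases "available G (greedy (remove v k i) s) s j")
  case True
  let ?w = "remove v k i"
  have "j \<in> candidates ?w s"
    using True matched_candidate[OF m] \<open>j \<noteq> i\<close> by (simp add: mem_candidates reprice_other)
  moreover have "?w s l \<le> v s l" if "l \<in> candidates ?w s" for l
    using that s by (cases "l = i") (auto simp: mem_candidates reprice_def)
  ultimately have "matched ?w s j"
    unfolding matched_def
    using candidates_remove_subset[OF s matched_arrival[OF m]] \<open>j \<noteq> i\<close>
    by (intro best_mono[OF m[unfolded matched_def]]) (simp_all add: reprice_other)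
  with s show ?thesis by blast
next
  case False
  have "j \<notin> carried_over (remove v k i) s"
    using matched_candidate[OF m] carried_over_not_available[of j v s] s
    by (auto simp: mem_candidates carried_over_reprice)
  with False matched_arrival[OF m] s show ?thesis by (metis not_available_cases)
qed

context
  fixes v :: "nat \<Rightarrow> 'i \<Rightarrow> real" and i :: 'i and b T :: nat
  assumes b: "matched v b i" "period G b = period G T - 1"
    and T: "T < num_arrivals G" and blocked: "blocks b T"
begin

lemma blocks_after:
  assumes "b \<le> s" "matched w s j" "t \<le> T"
  shows "blocks s t"
  using assms T matched_arrival[OF assms(2)] by (intro blocks_later[OF blocks_earlier[OF blocked]])

lemma carried_over_remove_previous:
  assumes t: "t \<le> T" "period G t = period G T"
  shows "carried_over v t - {i} \<subseteq> carried_over (remove v (period G T - 1) i) t"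
proof
  let ?k = "period G T - 1"
  fix j assume "j \<in> carried_over v t - {i}"
  then obtain s where s: "period G s = ?k" "matched v s j"
      "blocks s t" and "j \<noteq> i"
    using t by (auto elim: carried_over_previous_period)
  obtain s' where s': "period G s' = ?k" "matched (remove v ?k i) s' j"
    using matched_remove_other[OF s(2,1) \<open>j \<noteq> i\<close>] by blast
  show "j \<in> carried_over (remove v ?k i) t"
  proof (cases "s' < b")
    case True
    then have "matched v s' j" using s' matched_remove_before[OF b] by simp
    then have "s' = s" using matched_once_per_period s s' by simp
    with s s' t show ?thesis by (auto simp: carried_over_def intro!: exI[of _ s])
  next
    case False
    then have "blocks s' t"
      using blocks_after s'(2) t(1) by simp
    with s' t show ?thesis by (auto simp: carried_over_def intro!: exI[of _ s'])
  qed
qed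

lemma carried_over_remove_previous_persists:
  assumes "s \<le> t" "t \<le> T" "period G s = period G T" "period G t = period G T"
  shows "carried_over (remove v (period G T - 1) i) s - carried_over v s
    \<subseteq> carried_over (remove v (period G T - 1) i) t"
proof
  let ?w = "remove v (period G T - 1) i"
  fix j assume j: "j \<in> carried_over ?w s - carried_over v s"
  then obtain s' where s': "period G s' < period G s" "matched ?w s' j"
      "blocks s' s"
    by (auto simp: carried_over_def)
  have "\<not> s' < b"
  proof
    assume "s' < b"
    then have "matched v s' j" using s'(2) matched_remove_before[OF b] by simp
    with s' j show False by (auto simp: carried_over_def)
  qed
  then have "blocks s' t"
    using blocks_after s'(2) assms(2) by simp
  with s' assms show "j \<in> carried_over ?w t" by (auto simp: carried_over_def)
qed

lemma utility_remove_previous_le: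
  assumes "\<And>t. period G t = period G T \<Longrightarrow> v t i \<le> 0"
  shows "utility (remove v (period G T - 1) i) T \<le> utility v T"
proof (rule utility_mono)
  show "candidates (remove v (period G T - 1) i) T \<subseteq> candidates v T"
    using T assms
    by (intro candidates_mono[where k = "period G T" and i = i and T = T]
        carried_over_remove_previous carried_over_remove_previous_persists)
      (simp_all add: reprice_other)
qed (simp add: reprice_other)

end

section \<open>Charging matches to the edges of a feasible matching\<close>

lemma feasible_matching_subset: "feasible_matching G N \<Longrightarrow> N \<subseteq> resources G \<times> {..<num_arrivals G}"
  by (auto simp: feasible_matching_def intro: edge_resource edge_arrival)

lemma finite_feasible_matching: "feasible_matching G N \<Longrightarrow> finite N"
  using feasible_matching_subset finite_subset finite_resources by blast

lemma feasible_matching_not_blocks: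
  assumes "feasible_matching G N" "(i, s) \<in> N" "(i, t) \<in> N" "s < t"
  shows "\<not> blocks s t"
proof -
  have "available G {(j, s) \<in> N. s < t} t i"
    using assms(1,3) unfolding feasible_matching_def by blast
  with assms(2,4) show ?thesis by (auto simp: available_def blocks_def not_le)
qed

lemma Offline_attained:
  obtains N where "feasible_matching G N" "Offline G = total_reward G N"
proof -
  have "{N. feasible_matching G N} \<subseteq> Pow (resources G \<times> {..<num_arrivals G})"
    using feasible_matching_subset by blast
  then have "finite {N. feasible_matching G N}"
    by (rule finite_subset) (simp add: finite_resources)
  moreover have "feasible_matching G {}" by (simp add: feasible_matching_def)
  ultimately have "Offline G \<in> total_reward G ` {N. feasible_matching G N}"
    unfolding Offline_def by (intro Max_in) auto
  then show thesis using that by blast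
qed

lemma total_reward_nonneg: "M \<subseteq> resources G \<times> UNIV \<Longrightarrow> 0 \<le> total_reward G M"
  unfolding total_reward_def by (auto intro!: sum_nonneg reward_nonneg)

lemma Offline_nonneg: "0 \<le> Offline G"
proof -
  obtain N where "feasible_matching G N" "Offline G = total_reward G N"
    by (rule Offline_attained)
  then show ?thesis using feasible_matching_subset[of N] by (auto intro!: total_reward_nonneg)
qed

lemma sum_utility_le:
  assumes N: "feasible_matching G N"
  shows "(\<Sum>(i, t)\<in>N. utility v t) \<le> (\<Sum>t<num_arrivals G. utility v t)"
proof -
  have "i = j" if "(i, t) \<in> N" "(j, t) \<in> N" for i j t
    using N that unfolding feasible_matching_def by blast
  then have "inj_on snd N" by (intro inj_onI) auto
  then have "(\<Sum>(i, t)\<in>N. utility v t) = (\<Sum>t\<in>snd ` N. utility v t)"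
    by (simp add: sum.reindex case_prod_beta')
  also have "\<dots> \<le> (\<Sum>t<num_arrivals G. utility v t)"
    using feasible_matching_subset[OF N] by (intro sum_mono2) (auto intro: utility_nonneg)
  finally show ?thesis .
qed

definition charged :: "(nat \<Rightarrow> 'i \<Rightarrow> real) \<Rightarrow> 'i \<Rightarrow> nat \<Rightarrow> nat set" where
  "charged v i t = {s. matched v s i \<and>
    (s \<le> t \<and> period G s = period G t \<or>
     period G s < period G t \<and> blocks s t)}"

lemma charged_subset: "charged v i t \<subseteq> {..<num_arrivals G}"
  by (auto simp: charged_def intro: matched_arrival)

lemma finite_charged: "finite (charged v i t)"
  using charged_subset by (rule finite_subset) simp

lemma charged_disjoint:
  assumes "\<not> blocks t t'" "t < t'" "t' < num_arrivals G"
  shows "charged v i t \<inter> charged v i t' = {}"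
proof (rule ccontr)
  assume "\<not> ?thesis"
  then obtain s where s: "s \<in> charged v i t" "s \<in> charged v i t'" by blast
  have "period G t \<noteq> period G t'"
    using blocks_if_same_period[of t t'] assms(1) by auto
  then have "period G t < period G t'" using period_mono[of t t'] assms by simp
  then have "blocks s t'" using s by (auto simp: charged_def)
  then have "\<not> s \<le> t" using blocks_later[of s t' t] assms by auto
  then show False using s period_mono[of t s] by (auto simp: charged_def dest: matched_arrival)
qed

lemma charged_unique:
  assumes N: "feasible_matching G N" and "(i, t) \<in> N" "(i, t') \<in> N"
    and "s \<in> charged v i t" "s \<in> charged v i t'"
  shows "t = t'"
proof (rule ccontr)
  have disjoint: "charged v i r \<inter> charged v i r' = {}"
    if "(i, r) \<in> N" "(i, r') \<in> N" "r < r'" for r r'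
    using charged_disjoint feasible_matching_not_blocks[OF N that] that
      feasible_matching_subset[OF N] by blast
  assume "t \<noteq> t'"
  then consider "t < t'" | "t' < t" by linarith
  then show False by cases (use disjoint assms(2-) in blast)+
qed

lemma sum_charged_le:
  fixes f :: "'i \<Rightarrow> nat \<Rightarrow> real"
  assumes N: "feasible_matching G N"
    and nonneg: "\<And>i s. i \<in> resources G \<Longrightarrow> 0 \<le> f i s"
  shows "(\<Sum>(i, t)\<in>N. \<Sum>s\<in>charged v i t. f i s) \<le> (\<Sum>(i, s)\<in>greedy v (num_arrivals G). f i s)"
proof -
  let ?P = "SIGMA (i, t):N. charged v i t" and ?m = "\<lambda>((i, t), s). (i, s)"
  have "inj_on ?m ?P"
    using charged_unique[OF N] by (auto simp: inj_on_def)
  have "(\<Sum>(i, t)\<in>N. \<Sum>s\<in>charged v i t. f i s) = (\<Sum>((i, t), s)\<in>?P. f i s)"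
    using finite_feasible_matching[OF N] finite_charged
    by (simp add: sum.Sigma case_prod_beta')
  also have "\<dots> = (\<Sum>(i, s)\<in>?m ` ?P. f i s)"
    by (subst sum.reindex[OF \<open>inj_on ?m ?P\<close>]) (auto intro: sum.cong)
  also have "\<dots> \<le> (\<Sum>(i, s)\<in>greedy v (num_arrivals G). f i s)"
  proof (rule sum_mono2[OF finite_greedy])
    show "?m ` ?P \<subseteq> greedy v (num_arrivals G)"
      by (auto simp: charged_def mem_greedy intro: matched_arrival)
    show "0 \<le> (case p of (i, s) \<Rightarrow> f i s)" if "p \<in> greedy v (num_arrivals G) - ?m ` ?P" for p
      using that nonneg by (cases p) (auto simp: mem_greedy dest: matched_resource)
  qed
  finally show ?thesis .
qed

end

section \<open>The gain of an edge\<close>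

locale reranking = reusable_resources G for G :: "'i omr" +
  fixes \<beta> :: real
  assumes \<beta>_pos: "0 < \<beta>"
begin

definition val :: "(int \<times> 'i \<Rightarrow> real) \<Rightarrow> nat \<Rightarrow> 'i \<Rightarrow> real" where
  "val y t i = reward G i * (1 - g \<beta> (y (period G t, i)))"

lemma val_upd: "val (y((k, i) := x)) = reprice (val y) k i (reward G i * (1 - g \<beta> x))"
  by (auto simp: val_def reprice_def fun_eq_iff)

lemma val_upd_1: "val (y((k, i) := 1)) = remove (val y) k i"
  by (simp add: val_upd g_1)

definition edge_gain :: "(int \<times> 'i \<Rightarrow> real) \<Rightarrow> 'i \<Rightarrow> nat \<Rightarrow> real" where
  "edge_gain y i t = utility (val y) t +
    (\<Sum>s\<in>charged (val y) i t. reward G i * g \<beta> (y (period G s, i)))"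

lemma edge_gain_nonneg: "i \<in> resources G \<Longrightarrow> 0 \<le> edge_gain y i t"
  unfolding edge_gain_def
  by (auto intro!: add_nonneg_nonneg sum_nonneg mult_nonneg_nonneg utility_nonneg
      reward_nonneg g_nonneg)

lemma sum_edge_gain_le_reward:
  assumes N: "feasible_matching G N"
  shows "(\<Sum>(i, t)\<in>N. edge_gain y i t) \<le> total_reward G (greedy (val y) (num_arrivals G))"
proof -
  let ?n = "num_arrivals G" and ?share = "\<lambda>i s. reward G i * g \<beta> (y (period G s, i))"
  have "(\<Sum>(i, t)\<in>N. edge_gain y i t) =
      (\<Sum>(i, t)\<in>N. utility (val y) t) + (\<Sum>(i, t)\<in>N. \<Sum>s\<in>charged (val y) i t. ?share i s)"
    by (simp add: edge_gain_def sum.distrib case_prod_beta')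
  also have "\<dots> \<le> (\<Sum>t<?n. utility (val y) t) + (\<Sum>(i, s)\<in>greedy (val y) ?n. ?share i s)"
    using N by (intro add_mono sum_utility_le sum_charged_le) (simp_all add: reward_nonneg g_nonneg)
  also have "\<dots> = (\<Sum>(i, s)\<in>greedy (val y) ?n. val y s i + ?share i s)"
    by (simp add: sum_utility sum.distrib case_prod_beta')
  also have "\<dots> = total_reward G (greedy (val y) ?n)"
    by (simp add: total_reward_def val_def algebra_simps)
  finally show ?thesis .
qed

text \<open>
  For a seed \<open>x\<close> of \<open>i\<close>, arrival \<open>t\<close> prefers \<open>i\<close> to what it is paid without \<open>i\<close> iff
  \<open>g \<beta> x < critical y i t\<close>.
\<close>

definition critical :: "(int \<times> 'i \<Rightarrow> real) \<Rightarrow> 'i \<Rightarrow> nat \<Rightarrow> real" where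
  "critical y i t = 1 - utility (remove (val y) (period G t) i) t / reward G i"

lemma critical_upd: "critical (y((period G t, i) := w)) i t = critical y i t"
  by (simp add: critical_def val_upd)

context
  fixes i :: 'i and t :: nat
  assumes edge: "(i, t) \<in> edges G" and reward_pos: "0 < reward G i"
begin

lemma utility_remove_eq_critical:
  "utility (remove (val y) (period G t) i) t = reward G i * (1 - critical y i t)"
  using reward_pos by (simp add: critical_def)

lemma critical_le_1: "critical y i t \<le> 1"
  using reward_pos utility_nonneg by (simp add: critical_def)

lemma edge_gain_ge_uncharged: "reward G i * (1 - critical y i t) \<le> edge_gain y i t"
proof -
  have "0 \<le> (\<Sum>s\<in>charged (val y) i t. reward G i * g \<beta> (y (period G s, i)))"
    using reward_pos by (intro sum_nonneg) (simp add: g_nonneg)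
  then show ?thesis
    using utility_remove_le[OF refl edge_arrival[OF edge], of "val y" i]
    by (simp add: edge_gain_def utility_remove_eq_critical)
qed

lemma edge_gain_ge_charged:
  assumes "s \<in> charged (val y) i t"
  shows "reward G i * (1 - critical y i t + g \<beta> (y (period G s, i))) \<le> edge_gain y i t"
proof -
  have "reward G i * g \<beta> (y (period G s, i)) \<le>
      (\<Sum>s\<in>charged (val y) i t. reward G i * g \<beta> (y (period G s, i)))"
    using reward_pos assms by (intro member_le_sum finite_charged) (simp_all add: g_nonneg)
  then show ?thesis
    using utility_remove_le[OF refl edge_arrival[OF edge], of "val y" i]
    by (simp add: edge_gain_def utility_remove_eq_critical distrib_left)
qed

lemma nn_integral_edge_gain_ge_if_carried_over:
  assumes "i \<in> carried_over (val y) t"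
  shows "ennreal (reward G i * (1 - critical y i t + g \<beta> (y (period G t - 1, i))))
    \<le> (\<integral>\<^sup>+ w. edge_gain (y((period G t, i) := w)) i t \<partial>unif01)"
proof -
  let ?y = "\<lambda>w. y((period G t, i) := w)"
  have "reward G i * (1 - critical y i t + g \<beta> (y (period G t - 1, i))) \<le> edge_gain (?y w) i t"
    for w
  proof -
    have "i \<in> carried_over (val (?y w)) t" using assms by (simp add: val_upd carried_over_reprice)
    then obtain s where "s \<in> charged (val (?y w)) i t" "period G s = period G t - 1"
      by (rule carried_over_previous_period) (auto simp: charged_def)
    then show ?thesis using edge_gain_ge_charged[of s "?y w"] by (simp add: critical_upd)
  qed
  then have "(\<integral>\<^sup>+ w. reward G i * (1 - critical y i t + g \<beta> (y (period G t - 1, i))) \<partial>unif01)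
      \<le> (\<integral>\<^sup>+ w. edge_gain (?y w) i t \<partial>unif01)"
    by (intro nn_integral_mono ennreal_leI)
  then show ?thesis by (simp add: unif01.emeasure_space_1 del: space_uniform_measure)
qed

lemma edge_gain_ge_if_not_carried_over:
  assumes "i \<notin> carried_over (val y) t"
  defines "x \<equiv> y (period G t, i)"
  shows "reward G i * (1 - critical y i t + (if g \<beta> x < critical y i t then g \<beta> x else 0))
    \<le> edge_gain y i t"
proof (cases "g \<beta> x < critical y i t")
  case True
  then have "utility (remove (val y) (period G t) i) t < val y t i"
    using reward_pos by (simp add: utility_remove_eq_critical val_def x_def)
  then obtain s where "s \<le> t" "period G s = period G t" "matched (val y) s i"
    using matched_if_utility_remove_less[OF edge assms(1)] by blast
  then show ?thesis
    using edge_gain_ge_charged[of s y] True by (simp add: charged_def x_def)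
qed (simp add: edge_gain_ge_uncharged)

lemma nn_integral_edge_gain_ge_if_not_carried_over:
  assumes "i \<notin> carried_over (val y) t"
  shows "ennreal (reward G i * (1 - critical y i t + g_mass_below \<beta> (critical y i t)))
    \<le> (\<integral>\<^sup>+ w. edge_gain (y((period G t, i) := w)) i t \<partial>unif01)"
proof -
  let ?u = "critical y i t" and ?r = "reward G i"
  let ?h = "\<lambda>w. if g \<beta> w < ?u then g \<beta> w else 0"
  have "ennreal (?r * (1 - ?u + g_mass_below \<beta> ?u)) =
      ennreal (?r * (1 - ?u)) + ennreal ?r * (\<integral>\<^sup>+ w. ennreal (?h w) \<partial>unif01)"
    using nn_integral_g_below[OF \<beta>_pos critical_le_1] reward_pos critical_le_1[of y]
    by (simp add: distrib_left ennreal_mult g_mass_below_nonneg)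
  also have "\<dots> = (\<integral>\<^sup>+ w. ennreal (?r * (1 - ?u)) + ennreal ?r * ennreal (?h w) \<partial>unif01)"
    using unif01.emeasure_space_1
    by (simp add: nn_integral_add nn_integral_cmult del: space_uniform_measure)
  also have "\<dots> = (\<integral>\<^sup>+ w. ennreal (?r * (1 - ?u + ?h w)) \<partial>unif01)"
    using reward_pos critical_le_1[of y]
    by (intro nn_integral_cong) (simp add: distrib_left ennreal_mult g_nonneg)
  also have "\<dots> \<le> (\<integral>\<^sup>+ w. edge_gain (y((period G t, i) := w)) i t \<partial>unif01)"
  proof (intro nn_integral_mono ennreal_leI)
    fix w
    have "i \<notin> carried_over (val (y((period G t, i) := w))) t"
      using assms by (simp add: val_upd carried_over_reprice)
    from edge_gain_ge_if_not_carried_over[OF this]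
    show "?r * (1 - ?u + ?h w) \<le> edge_gain (y((period G t, i) := w)) i t"
      by (simp add: critical_upd split: if_splits)
  qed
  finally show ?thesis .
qed

lemma critical_le_removed_if_carried_over:
  assumes "i \<in> carried_over (val y) t"
  shows "critical y i t \<le> critical (y((period G t - 1, i) := 1)) i t"
proof -
  let ?v = "remove (val y) (period G t) i"
  obtain b where b: "period G b = period G t - 1" "matched (val y) b i"
      "blocks b t"
    using assms by (rule carried_over_previous_period)
  then have "matched ?v b i" by (simp add: matched_reprice_later_period)
  then have "utility (remove ?v (period G t - 1) i) t \<le> utility ?v t"
    using b edge_arrival[OF edge]
    by (intro utility_remove_previous_le[where b = b]) (simp_all add: reprice_same)
  then show ?thesis
    using reward_pos by (simp add: critical_def val_upd_1 reprice_commute divide_right_mono)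
qed

lemma critical_eq_removed_if_unmatched:
  assumes "\<And>s. period G s = period G t - 1 \<Longrightarrow> \<not> matched (val y) s i"
  shows "critical y i t = critical (y((period G t - 1, i) := 1)) i t"
proof -
  let ?v = "remove (val y) (period G t) i"
  have "utility (remove ?v (period G t - 1) i) t = utility ?v t"
    using assms by (intro utility_remove_unmatched) (simp_all add: matched_reprice_later_period)
  then show ?thesis by (simp add: critical_def val_upd_1 reprice_commute)
qed

lemma nn_integral_edge_gain_ge_if_returned:
  assumes "\<beta> \<le> 1" "returned (val y) i t"
  shows "ennreal (reward G i * (1 - g \<beta> 0)) \<le>
    (\<integral>\<^sup>+ w. edge_gain (y((period G t, i) := w)) i t \<partial>unif01)"
proof -
  have "ennreal (reward G i * (1 - g \<beta> 0)) \<le>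
      ennreal (reward G i * (1 - critical y i t + g_mass_below \<beta> (critical y i t)))"
    using le_g_mass_below[OF \<beta>_pos assms(1), of "critical y i t"] reward_pos
    by (intro ennreal_leI mult_left_mono) auto
  also have "\<dots> \<le> (\<integral>\<^sup>+ w. edge_gain (y((period G t, i) := w)) i t \<partial>unif01)"
    by (intro nn_integral_edge_gain_ge_if_not_carried_over returned_not_carried_over assms(2))
  finally show ?thesis .
qed

lemma nn_integral_edge_gain_ge_if_not_returned:
  fixes y
  assumes "\<not> returned (val y) i t"
  defines "u \<equiv> critical (y((period G t - 1, i) := 1)) i t"
  shows "ennreal (reward G i * (1 - u + min (g \<beta> (y (period G t - 1, i))) (g_mass_below \<beta> u)))
    \<le> (\<integral>\<^sup>+ w. edge_gain (y((period G t, i) := w)) i t \<partial>unif01)"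
proof (cases "i \<in> carried_over (val y) t")
  case True
  have "critical y i t \<le> u" unfolding u_def by (rule critical_le_removed_if_carried_over[OF True])
  then show ?thesis
    using reward_pos
    by (intro order_trans[OF _ nn_integral_edge_gain_ge_if_carried_over[OF True]]
        ennreal_leI mult_left_mono) auto
next
  case False
  have "critical y i t = u"
    unfolding u_def using matched_previous_period_cases assms(1) False
    by (intro critical_eq_removed_if_unmatched) blast
  then show ?thesis
    using reward_pos
    by (intro order_trans[OF _ nn_integral_edge_gain_ge_if_not_carried_over[OF False]]
        ennreal_leI mult_left_mono) auto
qed

lemma nn_integral_resampled_edge_gain_ge:
  assumes \<beta>: "\<beta> \<le> 1"
  shows "ennreal (competitive_ratio \<beta> * reward G i) \<le>
    (\<integral>\<^sup>+ x. \<integral>\<^sup>+ w. edge_gain (y((period G t - 1, i) := x, (period G t, i) := w)) i t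
      \<partial>unif01 \<partial>unif01)"
proof -
  let ?r = "reward G i" and ?y = "\<lambda>x. y((period G t - 1, i) := x)"
  define u where "u = critical (?y 1) i t"
  define h where "h x = ?r * (1 - u + min (g \<beta> x) (g_mass_below \<beta> u))" for x
  show ?thesis
  proof (rule nn_integral_ge_if_initial_segment[OF unif01.prob_space_axioms,
        where S = "\<lambda>x. returned (val (?y x)) i t" and h = "\<lambda>x. ennreal (h x)"
          and b = "ennreal (?r * (1 - g \<beta> 0))"])
    show "returned (val (?y x')) i t" if "returned (val (?y x)) i t" "x' < x" for x x'
      using that g_mono[OF \<beta>_pos, of x' x] reward_pos unfolding val_upd
      by (elim returned_raise) (auto intro: mult_left_mono)
    show "mono (\<lambda>x. ennreal (h x))"
      using g_mono[OF \<beta>_pos] reward_pos unfolding h_def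
      by (intro monoI ennreal_leI mult_left_mono add_left_mono min.mono) auto
    show "ennreal (?r * (1 - g \<beta> 0)) \<le>
        (\<integral>\<^sup>+ w. edge_gain ((?y x)((period G t, i) := w)) i t \<partial>unif01)"
      if "returned (val (?y x)) i t" for x
      by (rule nn_integral_edge_gain_ge_if_returned[OF \<beta> that])
    show "ennreal (h x) \<le> (\<integral>\<^sup>+ w. edge_gain ((?y x)((period G t, i) := w)) i t \<partial>unif01)"
      if "\<not> returned (val (?y x)) i t" for x
      using nn_integral_edge_gain_ge_if_not_returned[OF that] by (simp add: h_def u_def)
    show "ennreal (competitive_ratio \<beta> * ?r) \<le> ennreal (?r * (1 - g \<beta> 0))"
      using reward_pos
      by (intro ennreal_leI) (simp add: mult.commute mult_left_mono competitive_ratio_def)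
    show "ennreal (competitive_ratio \<beta> * ?r) \<le> (\<integral>\<^sup>+ x. ennreal (h x) \<partial>unif01)"
      unfolding h_def u_def using reward_pos
      by (intro competitive_ratio_le_nn_integral \<beta>_pos critical_le_1) simp
  qed
qed

end

section \<open>Random seeds\<close>

sublocale seeds: product_prob_space "\<lambda>_ :: int \<times> 'i. unif01" "UNIV \<times> resources G"
  rewrites "PiM (UNIV \<times> resources G) (\<lambda>_. unif01) = seeds G"
  by (intro product_prob_spaceI unif01.prob_space_axioms) (simp add: seeds_def)

lemma measurable_seed:
  assumes "i \<in> resources G"
  shows "(\<lambda>y. y (k, i)) \<in> borel_measurable (seeds G)"
proof -
  have "(\<lambda>y. y (k, i)) \<in> measurable (seeds G) unif01"
    unfolding seeds_def using assms by (intro measurable_component_singleton) simp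
  then show ?thesis by (simp cong: measurable_cong_sets)
qed

lemma measurable_val: "i \<in> resources G \<Longrightarrow> (\<lambda>y. val y t i) \<in> borel_measurable (seeds G)"
  unfolding val_def using measurable_seed[of i "period G t"] by measurable

lemma measurable_if_determined_by_comparisons:
  assumes "\<And>y y'. (\<And>t i. t < n \<Longrightarrow> i \<in> resources G \<Longrightarrow> 0 < val y t i \<longleftrightarrow> 0 < val y' t i) \<Longrightarrow>
    (\<And>t i j. t < n \<Longrightarrow> i \<in> resources G \<Longrightarrow> j \<in> resources G \<Longrightarrow>
      val y t i \<le> val y t j \<longleftrightarrow> val y' t i \<le> val y' t j) \<Longrightarrow> f y = f y'"
  shows "f \<in> measurable (seeds G) (count_space UNIV)"
proof -
  define positive where "positive = (\<lambda>(t, i) y. 0 < val y t i)"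
  define le where "le = (\<lambda>(t, i, j) y. val y t i \<le> val y t j)"
  let ?\<P> = "positive ` ({..<n} \<times> resources G) \<union> le ` ({..<n} \<times> resources G \<times> resources G)"
  show ?thesis
  proof (rule measurable_if_finitely_determined[of ?\<P>])
    show "Measurable.pred (seeds G) P" if "P \<in> ?\<P>" for P
      using that measurable_val unfolding pred_def
      by (auto simp: positive_def le_def intro!: borel_measurable_less borel_measurable_le)
    fix y y' :: "int \<times> 'i \<Rightarrow> real"
    assume same: "\<And>P. P \<in> ?\<P> \<Longrightarrow> P y = P y'"
    show "f y = f y'"
    proof (rule assms)
      show "0 < val y t i \<longleftrightarrow> 0 < val y' t i" if "t < n" "i \<in> resources G" for t i
      proof -
        have "positive (t, i) \<in> ?\<P>" using that by blast
        from same[OF this] show ?thesis by (simp add: positive_def)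
      qed
      show "val y t i \<le> val y t j \<longleftrightarrow> val y' t i \<le> val y' t j"
        if "t < n" "i \<in> resources G" "j \<in> resources G" for t i j
      proof -
        have "le (t, i, j) \<in> ?\<P>" using that by blast
        from same[OF this] show ?thesis by (simp add: le_def)
      qed
    qed
  qed (simp add: finite_resources)
qed

lemma measurable_greedy: "(\<lambda>y. greedy (val y) t) \<in> measurable (seeds G) (count_space UNIV)"
  by (rule measurable_if_determined_by_comparisons[of t]) (rule greedy_order_cong)

lemma measurable_matched [measurable]: "Measurable.pred (seeds G) (\<lambda>y. matched (val y) t i)"
proof -
  have "Measurable.pred (seeds G) (\<lambda>y. (i, t) \<in> greedy (val y) (Suc t))"
    by (rule measurable_compose[OF measurable_greedy]) simp
  then show ?thesis by (simp add: mem_greedy del: greedy.simps)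
qed

lemma measurable_utility [measurable]: "(\<lambda>y. utility (val y) t) \<in> borel_measurable (seeds G)"
proof -
  have "{i. matched (val y) t i} = {i \<in> resources G. matched (val y) t i}" for y
    by (auto intro: matched_resource)
  then have "utility (val y) t =
      (\<Sum>i\<in>resources G. if matched (val y) t i then val y t i else 0)" for y
    using finite_resources by (simp add: utility_def sum.inter_filter)
  moreover have "(\<lambda>y. \<Sum>i\<in>resources G. if matched (val y) t i then val y t i else 0)
      \<in> borel_measurable (seeds G)"
    by (intro borel_measurable_sum measurable_If measurable_val measurable_matched) auto
  ultimately show ?thesis by (simp only:)
qed

lemma measurable_edge_gain:
  assumes "i \<in> resources G"
  shows "(\<lambda>y. edge_gain y i t) \<in> borel_measurable (seeds G)"
proof -
  let ?share = "\<lambda>y s. reward G i * g \<beta> (y (period G s, i))"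
  have "charged (val y) i t = {s \<in> {..<num_arrivals G}. s \<in> charged (val y) i t}" for y
    using charged_subset by auto
  then have "edge_gain y i t = utility (val y) t +
      (\<Sum>s<num_arrivals G. if s \<in> charged (val y) i t then ?share y s else 0)" for y
    by (simp add: edge_gain_def sum.inter_filter[symmetric])
  moreover have "(\<lambda>y. \<Sum>s<num_arrivals G. if s \<in> charged (val y) i t then ?share y s else 0)
      \<in> borel_measurable (seeds G)"
  proof (rule borel_measurable_sum)
    fix s
    have [measurable]: "Measurable.pred (seeds G) (\<lambda>y. s \<in> charged (val y) i t)"
      unfolding charged_def mem_Collect_eq by measurable
    have [measurable]: "(\<lambda>y. y (period G s, i)) \<in> borel_measurable (seeds G)"
      using assms by (rule measurable_seed)
    show "(\<lambda>y. if s \<in> charged (val y) i t then ?share y s else 0) \<in> borel_measurable (seeds G)"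
      by measurable
  qed
  ultimately show ?thesis by simp
qed

lemma expected_edge_gain_ge:
  assumes \<beta>: "\<beta> \<le> 1" and edge: "(i, t) \<in> edges G"
  shows "ennreal (competitive_ratio \<beta> * reward G i) \<le> (\<integral>\<^sup>+ y. edge_gain y i t \<partial>seeds G)"
proof (cases "reward G i = 0")
  case False
  have i: "i \<in> resources G" using edge by (rule edge_resource)
  then have "0 < reward G i" using False reward_nonneg by fastforce
  let ?k = "period G t"
  let ?h = "\<lambda>y. \<integral>\<^sup>+ w. edge_gain (y((?k, i) := w)) i t \<partial>unif01"
  have meas: "(\<lambda>y. ennreal (edge_gain y i t)) \<in> borel_measurable (seeds G)"
    using measurable_edge_gain[OF i] by measurable
  have "ennreal (competitive_ratio \<beta> * reward G i) =
      (\<integral>\<^sup>+ y. ennreal (competitive_ratio \<beta> * reward G i) \<partial>seeds G)"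
    by (simp add: seeds.emeasure_space_1)
  also have "\<dots> \<le> (\<integral>\<^sup>+ y. \<integral>\<^sup>+ x. ?h (y((?k - 1, i) := x)) \<partial>unif01 \<partial>seeds G)"
    by (intro nn_integral_mono nn_integral_resampled_edge_gain_ge edge \<open>0 < reward G i\<close> \<beta>)
  also have "\<dots> = (\<integral>\<^sup>+ y. ?h y \<partial>seeds G)"
    using i meas by (intro seeds.nn_integral_PiM_resample) auto
  also have "\<dots> = (\<integral>\<^sup>+ y. edge_gain y i t \<partial>seeds G)"
    using i meas by (intro seeds.nn_integral_PiM_resample) auto
  finally show ?thesis .
qed simp

section \<open>Comparison with Periodic Reranking\<close>

lemma periodic_reranking_Suc:
  "periodic_reranking \<beta> tie G y (Suc t) =
    (let M = periodic_reranking \<beta> tie G y t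
     in if free M t = {} then M else insert (tie t (maximizers (val y t) (free M t)), t) M)"
proof -
  have "{i. is_arg_max (\<lambda>i. reward G i * (1 - g \<beta> (y (period G t, i)))) (\<lambda>i. i \<in> A) i} =
      maximizers (val y t) A" for A
    by (auto simp: maximizers_def is_arg_max_def val_def not_less)
  then show ?thesis by (simp only: periodic_reranking.simps Let_def free_def)
qed

lemma measurable_periodic_reranking:
  "(\<lambda>y. periodic_reranking \<beta> tie G y n) \<in> measurable (seeds G) (count_space UNIV)"
proof (rule measurable_if_determined_by_comparisons[of n])
  fix y y' :: "int \<times> 'i \<Rightarrow> real"
  assume comparisons: "\<And>t i j. t < n \<Longrightarrow> i \<in> resources G \<Longrightarrow> j \<in> resources G \<Longrightarrow>
    val y t i \<le> val y t j \<longleftrightarrow> val y' t i \<le> val y' t j"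
  then show "periodic_reranking \<beta> tie G y n = periodic_reranking \<beta> tie G y' n"
  proof (induction n)
    case (Suc t)
    have "periodic_reranking \<beta> tie G y t = periodic_reranking \<beta> tie G y' t"
      by (rule Suc.IH) (use Suc.prems in simp)
    moreover have "maximizers (val y t) (free M t) = maximizers (val y' t) (free M t)" for M
      using Suc.prems[of t] free_subset by (intro maximizers_cong) blast
    ultimately show ?case by (simp only: periodic_reranking_Suc)
  qed simp
qed

definition generic :: "(int \<times> 'i \<Rightarrow> real) \<Rightarrow> nat \<Rightarrow> bool" where
  "generic y t \<longleftrightarrow> (\<forall>i\<in>resources G. y (period G t, i) < 1) \<and>
    inj_on (val y t) {i \<in> resources G. 0 < reward G i}"

lemma AE_val_neq:
  assumes i: "i \<in> resources G" and j: "j \<in> resources G" and "i \<noteq> j" and r: "0 < reward G i"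
  shows "AE y in seeds G. val y t i \<noteq> val y t j"
proof (rule seeds.AE_PiM_resample[of "(period G t, i)"])
  show "Measurable.pred (seeds G) (\<lambda>y. val y t i \<noteq> val y t j)"
    unfolding pred_def using measurable_val[OF i, of t] measurable_val[OF j, of t]
    by (rule borel_measurable_neq)
  fix y :: "int \<times> 'i \<Rightarrow> real"
  let ?y = "\<lambda>x. y((period G t, i) := x)"
  have val_j: "val (?y x) t j = val y t j" for x using \<open>i \<noteq> j\<close> by (simp add: val_def)
  have val_i: "val (?y x) t i = reward G i * (1 - g \<beta> x)" for x by (simp add: val_def)
  show "AE x in unif01. val (?y x) t i \<noteq> val (?y x) t j"
  proof (cases "\<exists>x0. reward G i * (1 - g \<beta> x0) = val y t j")
    case True
    then obtain x0 where x0: "reward G i * (1 - g \<beta> x0) = val y t j" ..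
    show ?thesis using AE_unif01_not_eq[of x0]
    proof eventually_elim
      case (elim x)
      then have "g \<beta> x \<noteq> g \<beta> x0"
        using g_strict_mono[OF \<beta>_pos, of x x0] g_strict_mono[OF \<beta>_pos, of x0 x] by force
      then show ?case unfolding val_i val_j x0[symmetric] using r by simp
    qed
  next
    case False
    then show ?thesis unfolding val_i val_j by simp
  qed
qed (use i in simp)

lemma AE_generic: "AE y in seeds G. \<forall>t<num_arrivals G. generic y t"
proof -
  have "AE y in seeds G. y (period G t, i) < 1" if "i \<in> resources G" for t i
    using that AE_unif01 by (intro seeds.AE_component) (auto elim: eventually_mono)
  then have "AE y in seeds G. \<forall>t<num_arrivals G. \<forall>i\<in>resources G. y (period G t, i) < 1"
    using finite_resources by (simp add: AE_all_countable AE_finite_all)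
  moreover have "AE y in seeds G. \<forall>t<num_arrivals G. \<forall>i\<in>resources G. \<forall>j\<in>resources G.
      i \<noteq> j \<longrightarrow> 0 < reward G i \<longrightarrow> val y t i \<noteq> val y t j"
    using AE_val_neq finite_resources by (simp add: AE_all_countable AE_finite_all)
  ultimately show ?thesis
    by eventually_elim (simp add: generic_def inj_on_def, blast)
qed

lemma val_pos_iff:
  assumes "generic y t" "i \<in> resources G"
  shows "0 < val y t i \<longleftrightarrow> 0 < reward G i"
proof -
  have "g \<beta> (y (period G t, i)) < 1"
    using assms g_strict_mono[OF \<beta>_pos, of "y (period G t, i)" 1] by (simp add: generic_def g_1)
  then show ?thesis by (simp add: val_def zero_less_mult_iff)
qed

lemma candidates_eq_positive_free:
  assumes "generic y t" and greedy: "greedy (val y) t = {(i, s) \<in> M. 0 < reward G i}"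
  shows "candidates (val y) t = {i \<in> free M t. 0 < reward G i}"
proof -
  have "available G (greedy (val y) t) t i \<longleftrightarrow> available G M t i" if "0 < reward G i" for i
    using that unfolding greedy available_def by blast
  then show ?thesis
    using val_pos_iff[OF assms(1)] edge_resource by (auto simp: mem_candidates free_def)
qed

lemma matched_iff_positive_maximizer:
  assumes generic: "generic y t" and greedy: "greedy (val y) t = {(i, s) \<in> M. 0 < reward G i}"
  shows "matched (val y) t i \<longleftrightarrow> i \<in> maximizers (val y t) (free M t) \<and> 0 < reward G i"
proof -
  let ?v = "val y t"
  have candidates: "candidates (val y) t = {i \<in> free M t. 0 < reward G i}"
    using assms by (rule candidates_eq_positive_free)
  have matched_max: "?v j \<le> ?v i" if i: "matched (val y) t i" and j: "j \<in> free M t" for i j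
  proof (cases "0 < reward G j")
    case True
    then show ?thesis
      using i j best_ge[of ?v "candidates (val y) t" i j] by (simp add: matched_def candidates)
  next
    case False
    then have "\<not> 0 < ?v j" using val_pos_iff[OF generic] j free_subset by blast
    moreover have "0 < ?v i" using matched_candidate[OF i] by (simp add: mem_candidates)
    ultimately show ?thesis by simp
  qed
  show ?thesis
  proof
    assume i: "matched (val y) t i"
    then have "i \<in> free M t \<and> 0 < reward G i" using matched_candidate[OF i] candidates by blast
    with matched_max[OF i] show "i \<in> maximizers ?v (free M t) \<and> 0 < reward G i"
      by (simp add: maximizers_def)
  next
    assume i: "i \<in> maximizers ?v (free M t) \<and> 0 < reward G i"
    then have "i \<in> candidates (val y) t" by (simp add: candidates maximizers_def)
    then obtain j where j: "matched (val y) t j" using matched_exists by blast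
    then have "j \<in> free M t" "0 < reward G j" using matched_candidate[OF j] candidates by blast+
    moreover have "?v i = ?v j"
      using i matched_max[OF j] \<open>j \<in> free M t\<close> by (simp add: maximizers_def order_antisym)
    ultimately have "i = j"
      using generic i free_subset[of M t] by (auto simp: generic_def maximizers_def dest: inj_onD)
    with j show "matched (val y) t i" by simp
  qed
qed

context
  fixes tie :: "nat \<Rightarrow> 'i set \<Rightarrow> 'i"
  assumes tie: "\<And>t S. S \<subseteq> resources G \<Longrightarrow> S \<noteq> {} \<Longrightarrow> tie t S \<in> S"
begin

lemma tie_maximizers:
  assumes "free M t \<noteq> {}"
  shows "tie t (maximizers f (free M t)) \<in> maximizers f (free M t)"
proof (rule tie)
  show "maximizers f (free M t) \<subseteq> resources G"
    using free_subset by (auto simp: maximizers_def)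
  show "maximizers f (free M t) \<noteq> {}"
    using assms by (intro maximizers_nonempty free_subset)
qed

lemma periodic_reranking_subset: "periodic_reranking \<beta> tie G y t \<subseteq> resources G \<times> {..<t}"
proof (induction t)
  case (Suc t)
  let ?M = "periodic_reranking \<beta> tie G y t"
  have "tie t (maximizers (val y t) (free ?M t)) \<in> resources G" if "free ?M t \<noteq> {}"
    using tie_maximizers[OF that, of "val y t"] free_subset by (auto simp: maximizers_def)
  with Suc show ?case
    by (auto simp: periodic_reranking_Suc Let_def simp del: periodic_reranking.simps)
qed simp

lemma greedy_eq_positive_periodic_reranking:
  assumes "\<And>s. s < t \<Longrightarrow> generic y s"
  shows "greedy (val y) t = {(i, s) \<in> periodic_reranking \<beta> tie G y t. 0 < reward G i}"
  using assms
proof (induction t)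
  case (Suc t)
  let ?M = "periodic_reranking \<beta> tie G y t"
  let ?S = "maximizers (val y t) (free ?M t)"
  have IH: "greedy (val y) t = {(i, s) \<in> ?M. 0 < reward G i}" using Suc by simp
  have generic: "generic y t" using Suc.prems by simp
  have matched: "matched (val y) t i \<longleftrightarrow> i \<in> ?S \<and> 0 < reward G i" for i
    using generic IH by (rule matched_iff_positive_maximizer)
  have "{i. matched (val y) t i} = {i. free ?M t \<noteq> {} \<and> i = tie t ?S \<and> 0 < reward G i}"
  proof (cases "free ?M t = {}")
    case True
    then show ?thesis by (simp add: matched maximizers_def)
  next
    case False
    have tie_S: "tie t ?S \<in> ?S" using False by (rule tie_maximizers)
    have "i = tie t ?S" if i: "matched (val y) t i" for i
    proof -
      have "val y t i \<le> val y t (tie t ?S)" using i tie_S by (simp add: matched maximizers_def)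
      moreover have "0 < val y t i" using matched_candidate[OF i] by (simp add: mem_candidates)
      moreover have "tie t ?S \<in> resources G" using tie_S free_subset by (auto simp: maximizers_def)
      ultimately have "0 < reward G (tie t ?S)" using val_pos_iff[OF generic] by fastforce
      with tie_S have "matched (val y) t (tie t ?S)" by (simp add: matched)
      with i show ?thesis by (rule matched_unique)
    qed
    then show ?thesis using False tie_S matched by blast
  qed
  then show ?case
    by (auto simp: greedy_Suc IH periodic_reranking_Suc Let_def
        simp del: greedy.simps periodic_reranking.simps)
qed simp

lemma expected_reward_eq_greedy:
  "expected_reward \<beta> tie G = (\<integral>y. total_reward G (greedy (val y) (num_arrivals G)) \<partial>seeds G)"
  unfolding expected_reward_def
proof (rule integral_cong_AE)
  let ?n = "num_arrivals G"
  show "AE y in seeds G. total_reward G (periodic_reranking \<beta> tie G y ?n) =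
      total_reward G (greedy (val y) ?n)"
    using AE_generic
  proof eventually_elim
    case (elim y)
    let ?P = "periodic_reranking \<beta> tie G y ?n"
    have "finite ?P"
      using finite_resources by (intro finite_subset[OF periodic_reranking_subset]) simp
    then have "total_reward G ?P = total_reward G {(i, s) \<in> ?P. 0 < reward G i}"
      unfolding total_reward_def using periodic_reranking_subset reward_nonneg
      by (intro sum.mono_neutral_right) (fastforce simp: less_le)+
    then show ?case using elim greedy_eq_positive_periodic_reranking by simp
  qed
qed (auto intro: measurable_compose[OF measurable_periodic_reranking]
    measurable_compose[OF measurable_greedy])

lemma nn_integral_greedy_reward:
  "(\<integral>\<^sup>+ y. total_reward G (greedy (val y) (num_arrivals G)) \<partial>seeds G) = expected_reward \<beta> tie G"
  unfolding expected_reward_eq_greedy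
proof (rule nn_integral_eq_integral)
  let ?n = "num_arrivals G"
  have bound: "total_reward G (greedy v ?n) \<le> total_reward G (resources G \<times> {..<?n})" for v
    unfolding total_reward_def using greedy_subset finite_resources reward_nonneg
    by (intro sum_mono2) auto
  have nonneg: "0 \<le> total_reward G (greedy v ?n)" for v
    using greedy_subset by (intro total_reward_nonneg) blast
  show "integrable (seeds G) (\<lambda>y. total_reward G (greedy (val y) ?n))"
  proof (rule seeds.integrable_const_bound[where B = "total_reward G (resources G \<times> {..<?n})"])
    show "(\<lambda>y. total_reward G (greedy (val y) ?n)) \<in> borel_measurable (seeds G)"
      by (rule measurable_compose[OF measurable_greedy]) simp
  qed (use bound nonneg in simp)
  show "AE y in seeds G. 0 \<le> total_reward G (greedy (val y) ?n)" using nonneg by simp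
qed

theorem competitive_ratio_mult_Offline_le:
  assumes \<beta>: "\<beta> \<le> 1"
  shows "competitive_ratio \<beta> * Offline G \<le> expected_reward \<beta> tie G"
proof -
  obtain N where N: "feasible_matching G N" "Offline G = total_reward G N"
    by (rule Offline_attained)
  have edge: "p \<in> edges G" if "p \<in> N" for p
    using that N(1) by (auto simp: feasible_matching_def)
  then have resource: "fst p \<in> resources G" if "p \<in> N" for p
    using that by (metis edge_resource prod.collapse)
  have "competitive_ratio \<beta> * Offline G = (\<Sum>p\<in>N. competitive_ratio \<beta> * reward G (fst p))"
    by (simp add: N(2) total_reward_def sum_distrib_left case_prod_beta')
  then have "ennreal (competitive_ratio \<beta> * Offline G) =
      (\<Sum>p\<in>N. ennreal (competitive_ratio \<beta> * reward G (fst p)))"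
    using resource reward_nonneg competitive_ratio_nonneg[OF \<beta>_pos] by (simp add: sum_ennreal)
  also have "\<dots> \<le> (\<Sum>p\<in>N. \<integral>\<^sup>+ y. edge_gain y (fst p) (snd p) \<partial>seeds G)"
    using edge by (intro sum_mono expected_edge_gain_ge[OF \<beta>]) simp
  also have "\<dots> = (\<integral>\<^sup>+ y. (\<Sum>p\<in>N. ennreal (edge_gain y (fst p) (snd p))) \<partial>seeds G)"
    using measurable_edge_gain[OF resource] by (intro nn_integral_sum[symmetric]) simp
  also have "\<dots> = (\<integral>\<^sup>+ y. (\<Sum>(i, t)\<in>N. edge_gain y i t) \<partial>seeds G)"
    using resource edge_gain_nonneg by (simp add: sum_ennreal case_prod_beta')
  also have "\<dots> \<le> (\<integral>\<^sup>+ y. total_reward G (greedy (val y) (num_arrivals G)) \<partial>seeds G)"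
    by (intro nn_integral_mono ennreal_leI sum_edge_gain_le_reward[OF N(1)])
  also have "\<dots> = ennreal (expected_reward \<beta> tie G)" by (rule nn_integral_greedy_reward)
  finally have "ennreal (competitive_ratio \<beta> * Offline G) \<le> ennreal (expected_reward \<beta> tie G)" .
  moreover have "0 \<le> expected_reward \<beta> tie G"
    unfolding expected_reward_eq_greedy using greedy_subset
    by (intro Bochner_Integration.integral_nonneg total_reward_nonneg) blast
  ultimately show ?thesis by (simp add: ennreal_le_iff)
qed

end

end

theorem theorem1:
  fixes G :: "'i omr" and tie :: "nat \<Rightarrow> 'i set \<Rightarrow> 'i"
  assumes "omr_instance G"
    and "\<And>t S. S \<subseteq> resources G \<Longrightarrow> S \<noteq> {} \<Longrightarrow> tie t S \<in> S"
  shows "expected_reward 0.89 tie G \<ge> 0.589 * Offline G"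
proof -
  interpret reranking G "0.89"
    using assms(1) by unfold_locales auto
  have "0.589 * Offline G \<le> competitive_ratio 0.89 * Offline G"
    by (rule mult_right_mono[OF competitive_ratio_0_89 Offline_nonneg])
  also have "\<dots> \<le> expected_reward 0.89 tie G"
    using assms(2) by (rule competitive_ratio_mult_Offline_le) auto
  finally show ?thesis .
qed

end
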